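(* Let $k\ge 1$ be an integer. In each item below, $\lambda_1,\dots,\lambda_k\ge 0$ are arbitrary real numbers, $n$ is an arbitrary nonnegative integer, and $P$ is an arbitrary polynomial in $\mathbb{P}_n$. (1) (Laguerre-Sobolev case) Let $\alpha>-1$ and $w(x):=x^\alpha e^{-x}$ on $[0,\infty)$. Then $$\|P'\|_{W^{k,2}(w,\lambda_1w,\dots,\lambda_kw)}\le C_\alpha\, n\,\|P\|_{W^{k,2}(w,\lambda_1w,\dots,\lambda_kw)},$$ where $C_\alpha$ is the same constant as in the (non-Sobolev) Laguerre inequality $\|Q'\|_{L^2(w)}\le C_\alpha\, m\,\|Q\|_{L^2(w)}$, valid for all $m$ and all $Q\in\mathbb{P}_m$. (2) (Generalized Hermite-Sobolev case) Let $\alpha\ge 0$ and $w(x):=|x|^{\alpha}e^{-x^2}$ on $\mathbb{R}$. Then $$\|P'\|_{W^{k,2}(w,\lambda_1w,\dots,\lambda_kw)}\le \sqrt{2n}\,\|P\|_{W^{k,2}(w,\lambda_1w,\dots,\lambda_kw)}.$$ (3) (Jacobi-Sobolev case) Let $\alpha,\beta>-1$ and $w(x):=(1-x)^\alpha(1+x)^\beta$ on $[-1,1]$. Then $$\|P'\|_{W^{k,2}(w,\lambda_1w,\dots,\lambda_kw)}\le C_{\alpha,\beta}\, n^2\,\|P\|_{W^{k,2}(w,\lambda_1w,\dots,\lambda_kw)},$$ where $C_{\alpha,\beta}$ is the same constant as in the (non-Sobolev) Jacobi inequality $\|Q'\|_{L^2(w)}\le C_{\alpha,\beta}\, m^2\,\|Q\|_{L^2(w)}$,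 valid for all $m$ and all $Q\in\mathbb{P}_m$. (4) (Generalized Jacobi weight) Let $w(x):=h(x)\prod_{j=1}^r|x-c_j|^{\gamma_j}$ on a compact interval $[a,b]$, with $c_1,\dots,c_r\in\mathbb{R}$, $\gamma_1,\dots,\gamma_r\in\mathbb{R}$, $\gamma_j>-1$ when $c_j\in[a,b]$, and $h$ a measurable function satisfying $0<m\le h\le M$ on $[a,b]$ for some constants $m,M$. Then there is a constant $C_1=C_1(a,b,c_1,\dots,c_r,\gamma_1,\dots,\gamma_r,m,M)$ such that $$\|P'\|_{W^{k,2}(w,\lambda_1w,\dots,\lambda_kw)}\le C_1\, n^2\,\|P\|_{W^{k,2}(w,\lambda_1w,\dots,\lambda_kw)}.$$ (5) (Generalized Laguerre weight) Let $w(x):=h(x)\prod_{j=1}^r|x-c_j|^{\gamma_j}e^{-x}$ on $[0,\infty)$, with $c_1<\dots<c_r$ real, $c_r\ge 0$, $\gamma_1,\dots,\gamma_r\in\mathbb{R}$, $\gamma_j>-1$ when $c_j\ge 0$, and $h$ a measurable function satisfying $0<m\le h\le M$ on $[0,\infty)$ for some constants $m,M$. (5.1) If $\sum_{j=1}^{r-1}\gamma_j=0$, then there is a constant $C_2=C_2(c_1,\dots,c_r,\gamma_1,\dots,\gamma_r,m,M)$ such that $$\|P'\|_{W^{k,2}(w,\lambda_1w,\dots,\lambda_kw)}\le C_2\, n^2\,\|P\|_{W^{k,2}(w,\lambda_1w,\dots,\lambda_kw)}.$$ (5.2) Assume that $c_1<\dots<c_r$ and $\sum_{j=1}^r\gamma_j>-1$.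 Let $r_0:=\min\{1\le j\le r : c_j\ge 0\}$, $\gamma'_{r_0-1}:=\gamma'_{r+1}:=0$ and $\gamma'_j:=\gamma_j$ for every $r_0\le j\le r$. Assume that $\max\{\gamma'_j,\gamma'_{j+1}\}\ge -1/2$ for every $r_0-1\le j\le r$. Then there is a constant $C_2'=C_2'(c_1,\dots,c_r,\gamma_1,\dots,\gamma_r,m,M)$ such that $$\|P'\|_{W^{k,2}(w,\lambda_1w,\dots,\lambda_kw)}\le C_2'\, n^{a'}\,\|P\|_{W^{k,2}(w,\lambda_1w,\dots,\lambda_kw)},$$ where $$a':=\max\Big\{2,\frac{b'+2}{2}\Big\},\qquad b':=\max_{r_0-1\le j\le r}\big(\gamma'_j+\gamma'_{j+1}+|\gamma'_j-\gamma'_{j+1}|+2\big).$$ (6) (Generalized Hermite weight) Let $w(x):=h(x)\prod_{j=1}^r|x-c_j|^{\gamma_j}e^{-x^2}$ on $\mathbb{R}$, with $c_1<\dots<c_r$ real, $\gamma_1,\dots,\gamma_r>-1$ with $\sum_{j=1}^r\gamma_j\ge 0$, and $h$ a measurable function satisfying $0<m\le h\le M$ on $\mathbb{R}$ for some constants $m,M$. Define $\gamma_0:=\gamma_{r+1}:=0$ and assume that $\max\{\gamma_j,\gamma_{j+1}\}\ge -1/2$ for every $0\le j\le r$. Then there is a constant $C_3=C_3(c_1,\dots,c_r,\gamma_1,\dots,\gamma_r,m,M)$ such that $$\|P'\|_{W^{k,2}(w,\lambda_1w,\dots,\lambda_kw)}\le C_3\, n^{a}\,\|P\|_{W^{k,2}(w,\lambda_1w,\dots,\lambda_kw)},$$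 where $$a:=\max\Big\{2,\frac{b+1}{2}\Big\},\qquad b:=\max_{0\le j\le r}\big(\gamma_j+\gamma_{j+1}+|\gamma_j-\gamma_{j+1}|+2\big).$$ In each case the multiplicative constants depend just on the specified parameters (in particular, they do not depend on $n$).
   Context: $\mathbb{P}_n$ is the space of polynomials with real coefficients of degree at most $n$. For a weight $w$ (a nonnegative measurable function) defined on an interval $I\subseteq\mathbb{R}$, $\|P\|_{L^2(w)}:=\big(\int_I|P(x)|^2w(x)\,dx\big)^{1/2}$. For $\lambda_1,\dots,\lambda_k\ge0$, $$\|P\|_{W^{k,2}(w,\lambda_1w,\dots,\lambda_kw)}:=\Big(\|P\|_{L^2(w)}^2+\sum_{j=1}^k\|P^{(j)}\|^2_{L^2(\lambda_jw)}\Big)^{1/2}.$$ Known $L^2$ Markov-type inequalities, whose constants appear in items (1) and (3) (the constants are independent of $n$): (Laguerre) For every $\alpha>-1$ there is a constant $C_\alpha$ with $\|P'\|_{L^2(w)}\le C_\alpha n\|P\|_{L^2(w)}$ for all $n$ and $P\in\mathbb{P}_n$, where $w(x)=x^\alpha e^{-x}$ on $[0,\infty)$. (Jacobi) For every $\alpha,\beta>-1$ there is a constant $C_{\alpha,\beta}$ with $\|P'\|_{L^2(w)}\le C_{\alpha,\beta}n^2\|P\|_{L^2(w)}$ for all $n$ and $P\in\mathbb{P}_n$, where $w(x)=(1-x)^\alpha(1+x)^\beta$ on $[-1,1]$.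
   Formalization: In (4) it is also assumed that at each point of [a,b] the exponents γ_j of all c_j equal to that point sum to more than -1 (automatic for distinct c_j); otherwise the claim fails, e.g. |x|^{-3/4}|x|^{-3/4} with P = x and all λ_j = 0. *)

theory Defs
  imports "HOL-Analysis.Analysis" "HOL-Computational_Algebra.Polynomial"
begin

text \<open>
  The integral is the Bochner integral with respect to Lebesgue measure on \<open>I\<close>, which is \<open>0\<close> for
  non-integrable functions. For the weights considered here the integrand is always
  integrable, so this convention plays no role.
\<close>

definition L2_norm_wt :: "real set \<Rightarrow> (real \<Rightarrow> real) \<Rightarrow> real poly \<Rightarrow> real" where
  "L2_norm_wt I w P = sqrt (LINT x|lebesgue_on I. \<bar>poly P x\<bar>\<^sup>2 * w x)"

text \<open>The norm of \<open>W\<^sup>k\<^sup>,\<^sup>2(w, l\<^sub>1 w, \<dots>, l\<^sub>k w)\<close>; only \<open>l 1, \<dots>, l k\<close> are used.\<close>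

definition sobolev_norm ::
    "real set \<Rightarrow> (real \<Rightarrow> real) \<Rightarrow> nat \<Rightarrow> (nat \<Rightarrow> real) \<Rightarrow> real poly \<Rightarrow> real" where
  "sobolev_norm I w k l P =
     sqrt ((L2_norm_wt I w P)\<^sup>2
           + (\<Sum>j=1..k. (L2_norm_wt I (\<lambda>x. l j * w x) ((pderiv ^^ j) P))\<^sup>2))"

definition L2_markov :: "real set \<Rightarrow> (real \<Rightarrow> real) \<Rightarrow> (nat \<Rightarrow> real) \<Rightarrow> bool" where
  "L2_markov I w K \<longleftrightarrow>
     (\<forall>n P. degree P \<le> n \<longrightarrow> L2_norm_wt I w (pderiv P) \<le> K n * L2_norm_wt I w P)"

text \<open>
  The bound \<open>K n\<close> is uniform in the order \<open>k\<close>, in the parameters \<open>l\<close> and in the polynomial.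
\<close>

definition sobolev_markov :: "real set \<Rightarrow> (real \<Rightarrow> real) \<Rightarrow> (nat \<Rightarrow> real) \<Rightarrow> bool" where
  "sobolev_markov I w K \<longleftrightarrow>
     (\<forall>k\<ge>1. \<forall>l. (\<forall>j\<in>{1..k}. 0 \<le> l j) \<longrightarrow>
        (\<forall>n P. degree P \<le> n \<longrightarrow>
           sobolev_norm I w k l (pderiv P) \<le> K n * sobolev_norm I w k l P))"

text \<open>
  Since \<open>0 powr x = 0\<close>, the following functions vanish at the points where the base of a power
  is \<open>0\<close>, also for exponents \<open>\<le> 0\<close>; these points form a null set.
\<close>

definition laguerre_weight :: "real \<Rightarrow> real \<Rightarrow> real" where
  "laguerre_weight \<alpha> x = x powr \<alpha> * exp (- x)"

definition hermite_weight :: "real \<Rightarrow> real \<Rightarrow> real" where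
  "hermite_weight \<alpha> x = \<bar>x\<bar> powr \<alpha> * exp (- x\<^sup>2)"

definition jacobi_weight :: "real \<Rightarrow> real \<Rightarrow> real \<Rightarrow> real" where
  "jacobi_weight \<alpha> \<beta> x = (1 - x) powr \<alpha> * (1 + x) powr \<beta>"

definition power_prod :: "nat \<Rightarrow> (nat \<Rightarrow> real) \<Rightarrow> (nat \<Rightarrow> real) \<Rightarrow> real \<Rightarrow> real" where
  "power_prod r c \<gamma> x = (\<Prod>j=1..r. \<bar>x - c j\<bar> powr \<gamma> j)"

definition bounded_factor :: "real set \<Rightarrow> real \<Rightarrow> real \<Rightarrow> (real \<Rightarrow> real) \<Rightarrow> bool" where
  "bounded_factor I m M h \<longleftrightarrow>
     h \<in> borel_measurable (lebesgue_on I) \<and> (\<forall>x\<in>I. m \<le> h x \<and> h x \<le> M)"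

text \<open>
  \<open>pad p r \<gamma>\<close> is \<open>\<gamma>\<^sub>p, \<dots>, \<gamma>\<^sub>r\<close> extended by \<open>0\<close>; in particular it is \<open>0\<close> at \<open>p - 1\<close> and
  \<open>r + 1\<close>. It is only used for \<open>1 \<le> p\<close>.
\<close>

definition pad :: "nat \<Rightarrow> nat \<Rightarrow> (nat \<Rightarrow> real) \<Rightarrow> nat \<Rightarrow> real" where
  "pad p r \<gamma> j = (if p \<le> j \<and> j \<le> r then \<gamma> j else 0)"

text \<open>The quantities \<open>b\<close> (for \<open>p = 1\<close>) and \<open>b'\<close> (for \<open>p = r\<^sub>0\<close>).\<close>

definition b_exponent :: "nat \<Rightarrow> nat \<Rightarrow> (nat \<Rightarrow> real) \<Rightarrow> real" where
  "b_exponent p r \<gamma> =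
     Max ((\<lambda>j. pad p r \<gamma> j + pad p r \<gamma> (j + 1)
                + \<bar>pad p r \<gamma> j - pad p r \<gamma> (j + 1)\<bar> + 2) ` {p - 1..r})"

definition first_nonneg :: "nat \<Rightarrow> (nat \<Rightarrow> real) \<Rightarrow> nat" where
  "first_nonneg r c = Min {j \<in> {1..r}. 0 \<le> c j}"

end

theory Submission
  imports Defs
begin

text \<open>
  The square of the Sobolev norm is a combination, with nonnegative coefficients, of the squared
  weighted \<open>L\<^sup>2\<close> norms of the derivatives \<open>P\<^sup>(\<^sup>j\<^sup>)\<close>, all of degree at most \<open>n\<close>. Applying a Markov inequality
  \<open>\<parallel>Q'\<parallel> \<le> K\<^sub>n \<parallel>Q\<parallel>\<close> for the weight itself to each \<open>Q = P\<^sup>(\<^sup>j\<^sup>)\<close> and summing gives the Sobolev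
  inequality with the same \<open>K\<^sub>n\<close> (\<open>sobolev_markov_if_L2_markov\<close>). This settles the Laguerre and
  Jacobi families; for the other four it remains to prove the \<open>L\<^sup>2\<close> inequalities.

  These rest on one mechanism. Let \<open>L\<close> be the integral of a polynomial against a weight, and suppose
  that it satisfies a Pearson identity \<open>L (p f' + t f) = 0\<close> for all polynomials \<open>f\<close>, with
  \<open>deg p \<le> 2\<close> and \<open>deg t \<le> 1\<close>; this is integration by parts. Then \<open>f \<mapsto> p f'' + t f'\<close> is symmetric,
  does not raise the degree and is triangular in the monomials, so that its eigenvalues
  \<open>- \<mu>\<^sub>n\<close> can be read off; if \<open>\<mu>\<^sub>n\<close> increases strictly, then \<open>L (p f'\<^sup>2) \<le> \<mu>\<^sub>n L (f\<^sup>2)\<close> for \<open>deg f \<le> n\<close>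
  (\<open>bernstein\<close>).

  On a compact interval \<open>[a, b]\<close> with a two-sided Jacobi weight one has \<open>p = (x - a) (b - x)\<close> and
  \<open>\<mu>\<^sub>n = O(n\<^sup>2)\<close>. A second use of the Pearson identity, with a test function that changes sign in the
  middle of the interval, removes the factor \<open>p\<close> at the cost of another \<open>O(n\<^sup>2)\<close>
  (\<open>jac_endpoints\<close>); together these give the Markov inequality with \<open>n\<^sup>2\<close> (\<open>jac_markov\<close>), and
  iterating the second step compares weights with different exponents (\<open>jac_nikolskii\<close>).

  A generalized Jacobi weight is, between two consecutive points \<open>c\<^sub>j\<close>, comparable with a two-sided
  Jacobi weight. Since the squared inequalities are additive over subintervals, splitting \<open>[a, b]\<close> at
  the \<open>c\<^sub>j\<close> is enough (\<open>generalized_jacobi\<close>). A generalized Laguerre weight is treated in this way on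
  \<open>[0, A]\<close>, and on \<open>[A, \<infinity>)\<close> it varies by a bounded factor over each interval of length one, so that the
  unweighted inequality on unit intervals can be summed (\<open>generalized_laguerre\<close>); the resulting
  bound \<open>O(n\<^sup>2)\<close> is at least as good as the two bounds asserted for this family.

  For \<open>\<bar>x\<bar>\<^sup>\<alpha> exp (- x\<^sup>2)\<close> the even and the odd part of \<open>P\<close> are, after the substitution \<open>t = x\<^sup>2\<close>,
  polynomials in a Laguerre space, where the mechanism above yields the sharp \<open>2 n\<close>
  (\<open>hermite_markov\<close>). A generalized Hermite weight is comparable with such a weight outside a compact
  interval, with \<open>\<alpha> = \<Sum> \<gamma>\<^sub>j\<close>. Inside, the generalized Jacobi result applies; the price of exchanging
  the weights inside is a power \<open>n\<^sup>2\<^sup>k\<close>, where \<open>k\<close> is the least natural number that bounds all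
  \<open>\<gamma>\<^sub>j\<close>, and the exponent \<open>a\<close> absorbs it (\<open>generalized_hermite\<close>).
\<close>

section \<open>From weighted to Sobolev norms\<close>

lemma L2_norm_wt_nonneg:
  assumes "\<And>x. x \<in> I \<Longrightarrow> 0 \<le> w x"
  shows "0 \<le> L2_norm_wt I w P"
  unfolding L2_norm_wt_def
  by (intro real_sqrt_ge_zero Bochner_Integration.integral_nonneg) (use assms in auto)

lemma sqrt_pow2_abs: "(sqrt x)\<^sup>2 = \<bar>x\<bar>" for x :: real
  by (metis real_sqrt_abs real_sqrt_power)

lemma L2_norm_wt_scale:
  assumes "0 \<le> c"
  shows "(L2_norm_wt I (\<lambda>x. c * w x) P)\<^sup>2 = c * (L2_norm_wt I w P)\<^sup>2"
proof -
  have "(LINT x|lebesgue_on I. \<bar>poly P x\<bar>\<^sup>2 * (c * w x)) = c * (LINT x|lebesgue_on I. \<bar>poly P x\<bar>\<^sup>2 * w x)"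
    by (subst integral_mult_right_zero [symmetric]) (simp add: mult_ac)
  then show ?thesis
    using assms by (simp add: L2_norm_wt_def sqrt_pow2_abs abs_mult)
qed

lemma degree_pderiv_funpow: "degree ((pderiv ^^ j) P) \<le> degree (P :: real poly)"
proof (induction j)
  case (Suc j)
  then show ?case by (simp add: degree_pderiv)
qed simp

text \<open>
  The weighted inequality is applied to every derivative of \<open>P\<close> that occurs in the norm; their
  degrees do not exceed that of \<open>P\<close>, so one constant serves all of them.
\<close>

theorem sobolev_markov_if_L2_markov:
  assumes w: "\<And>x. x \<in> I \<Longrightarrow> 0 \<le> w x" and M: "L2_markov I w K"
  shows "sobolev_markov I w K"
  unfolding sobolev_markov_def
proof (intro allI impI)
  fix k :: nat and l :: "nat \<Rightarrow> real" and n and P :: "real poly"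
  assume l: "\<forall>j\<in>{1..k}. 0 \<le> l j" and deg: "degree P \<le> n"
  let ?N = "L2_norm_wt I w"
  have nn: "0 \<le> ?N Q" for Q
    using w by (rule L2_norm_wt_nonneg)
  have deg': "degree ((pderiv ^^ j) P) \<le> n" for j
    using degree_pderiv_funpow [of j P] deg by simp
  have base: "?N (pderiv ((pderiv ^^ j) P)) \<le> K n * ?N ((pderiv ^^ j) P)" for j
    using M deg' [of j] unfolding L2_markov_def by blast
  have sq: "(?N (pderiv ((pderiv ^^ j) P)))\<^sup>2 \<le> (K n)\<^sup>2 * (?N ((pderiv ^^ j) P))\<^sup>2" for j
    using power_mono [OF base [of j] nn] by (simp add: power_mult_distrib)
  have eq: "sobolev_norm I w k l Q = sqrt ((?N Q)\<^sup>2 + (\<Sum>j=1..k. l j * (?N ((pderiv ^^ j) Q))\<^sup>2))" for Q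
    using l by (simp add: sobolev_norm_def L2_norm_wt_scale)
  have comm: "(pderiv ^^ j) (pderiv P) = pderiv ((pderiv ^^ j) P)" for j
    by (simp add: funpow_swap1)
  have le: "(?N (pderiv P))\<^sup>2 + (\<Sum>j=1..k. l j * (?N ((pderiv ^^ j) (pderiv P)))\<^sup>2)
      \<le> (K n)\<^sup>2 * ((?N P)\<^sup>2 + (\<Sum>j=1..k. l j * (?N ((pderiv ^^ j) P))\<^sup>2))"
    unfolding distrib_left sum_distrib_left comm
  proof (intro add_mono sum_mono)
    show "(?N (pderiv P))\<^sup>2 \<le> (K n)\<^sup>2 * (?N P)\<^sup>2"
      using sq [of 0] by simp
    show "l j * (?N (pderiv ((pderiv ^^ j) P)))\<^sup>2 \<le> (K n)\<^sup>2 * (l j * (?N ((pderiv ^^ j) P))\<^sup>2)"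
      if "j \<in> {1..k}" for j
      using mult_left_mono [OF sq [of j], of "l j"] l that by (simp add: mult_ac)
  qed
  have abs: "sobolev_norm I w k l (pderiv P) \<le> \<bar>K n\<bar> * sobolev_norm I w k l P"
    unfolding eq using real_sqrt_le_mono [OF le] by (simp add: real_sqrt_mult)
  show "sobolev_norm I w k l (pderiv P) \<le> K n * sobolev_norm I w k l P"
  proof (cases "0 \<le> K n")
    case True
    then show ?thesis using abs by simp
  next
    \<comment> \<open>A negative constant forces every norm that occurs to vanish.\<close>
    case False
    have z: "?N ((pderiv ^^ j) P) = 0" for j
    proof (rule antisym [OF _ nn])
      have "0 \<le> K n * ?N ((pderiv ^^ j) P)"
        using base [of j] nn order_trans by blast
      then show "?N ((pderiv ^^ j) P) \<le> 0"
        using False by (simp add: zero_le_mult_iff nn)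
    qed
    then have "sobolev_norm I w k l P = 0"
      unfolding eq using z [of 0] z by simp
    then show ?thesis using abs by simp
  qed
qed

text \<open>
  All estimates are made for squared norms, written as Henstock-Kurzweil integrals, which split
  over adjacent sets. Integrability against all polynomials is carried along, because a divergent
  integral would silently count as \<open>0\<close>.
\<close>

definition poly_integrable :: "real set \<Rightarrow> (real \<Rightarrow> real) \<Rightarrow> bool" where
  "poly_integrable S w \<longleftrightarrow> (\<forall>f :: real poly. (\<lambda>x. poly f x * w x) integrable_on S)"

definition sq_int :: "real set \<Rightarrow> (real \<Rightarrow> real) \<Rightarrow> real poly \<Rightarrow> real" where
  "sq_int S w P = integral S (\<lambda>x. (poly P x)\<^sup>2 * w x)"

lemma sq_integrable:
  "poly_integrable S w \<Longrightarrow> (\<lambda>x. (poly P x)\<^sup>2 * w x) integrable_on S"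
  unfolding poly_integrable_def by (drule spec [of _ "P * P"]) (simp add: power2_eq_square)

lemma sq_int_nonneg:
  "poly_integrable S w \<Longrightarrow> (\<And>x. x \<in> S \<Longrightarrow> 0 \<le> w x) \<Longrightarrow> 0 \<le> sq_int S w P"
  unfolding sq_int_def
  by (intro Henstock_Kurzweil_Integration.integral_nonneg sq_integrable) auto

lemma L2_norm_wt_eq:
  assumes "poly_integrable I w" "I \<in> sets lebesgue" "\<And>x. x \<in> I \<Longrightarrow> 0 \<le> w x"
  shows "L2_norm_wt I w P = sqrt (sq_int I w P)"
proof -
  have "(\<lambda>x. (poly P x)\<^sup>2 * w x) absolutely_integrable_on I"
    using assms by (intro nonnegative_absolutely_integrable_1 sq_integrable) auto
  then have "integrable (lebesgue_on I) (\<lambda>x. (poly P x)\<^sup>2 * w x)"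
    using assms by (simp add: integrable_restrict_space set_integrable_def)
  then show ?thesis
    unfolding L2_norm_wt_def sq_int_def using lebesgue_integral_eq_integral assms(2) by fastforce
qed

lemma poly_integrable_dominated:
  assumes S: "S \<in> sets lebesgue" and v: "poly_integrable S v" "\<And>x. x \<in> S \<Longrightarrow> 0 \<le> v x"
    and w: "w \<in> borel_measurable (lebesgue_on S)" "\<And>x. x \<in> S \<Longrightarrow> \<bar>w x\<bar> \<le> M * v x"
  shows "poly_integrable S w"
  unfolding poly_integrable_def
proof
  fix f :: "real poly"
  have f: "poly f \<in> borel_measurable (lebesgue_on S)"
    by (intro continuous_imp_measurable_on_sets_lebesgue S continuous_intros)
  show "(\<lambda>x. poly f x * w x) integrable_on S"
  proof (rule measurable_bounded_by_integrable_imp_integrable_real [OF _ _ _ S])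
    show "(\<lambda>x. poly f x * w x) \<in> borel_measurable (lebesgue_on S)"
      using f w(1) by (rule borel_measurable_times)
    \<comment> \<open>\<open>1 + f\<^sup>2\<close> is a polynomial that dominates \<open>\<bar>f\<bar>\<close>.\<close>
    have "(\<lambda>x. poly (1 + f * f) x * v x) integrable_on S"
      using v(1) unfolding poly_integrable_def by blast
    then show "(\<lambda>x. M * (poly (1 + f * f) x * v x)) integrable_on S"
      by (rule integrable_on_mult_right)
    show "\<bar>poly f x * w x\<bar> \<le> M * (poly (1 + f * f) x * v x)" if "x \<in> S" for x
    proof -
      have "0 \<le> (\<bar>poly f x\<bar> - 1)\<^sup>2" by simp
      also have "\<dots> = (poly f x)\<^sup>2 + 1 - 2 * \<bar>poly f x\<bar>"
        by (simp add: power2_eq_square algebra_simps)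
      finally have "\<bar>poly f x\<bar> \<le> 1 + (poly f x)\<^sup>2"
        using abs_ge_zero [of "poly f x"] by linarith
      then have "\<bar>poly f x\<bar> * \<bar>w x\<bar> \<le> (1 + (poly f x)\<^sup>2) * (M * v x)"
        using w(2) [OF that] by (intro mult_mono) auto
      then show ?thesis by (simp add: abs_mult power2_eq_square mult_ac)
    qed
  qed
qed

text \<open>
  The form in which weights are exchanged throughout: pointwise two-sided bounds between weights pass
  to the squared norms.
\<close>

lemma comparable_weight:
  assumes S: "S \<in> sets lebesgue" and v: "poly_integrable S v" "\<And>x. x \<in> S \<Longrightarrow> 0 \<le> v x"
    and w: "w \<in> borel_measurable (lebesgue_on S)"
    and m: "0 < m" "\<And>x. x \<in> S \<Longrightarrow> m * v x \<le> w x" "\<And>x. x \<in> S \<Longrightarrow> w x \<le> M * v x"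
  shows "poly_integrable S w" "m * sq_int S v P \<le> sq_int S w P" "sq_int S w P \<le> M * sq_int S v P"
proof -
  have "0 \<le> w x" if "x \<in> S" for x
    using m(2) [OF that] v(2) [OF that] m(1) mult_nonneg_nonneg [of m "v x"] by linarith
  then show int: "poly_integrable S w"
    using m(3) by (intro poly_integrable_dominated [OF S v w, of M]) auto
  have "integral S (\<lambda>x. m * ((poly P x)\<^sup>2 * v x)) \<le> sq_int S w P"
    unfolding sq_int_def
  proof (rule integral_le [OF integrable_on_mult_right [OF sq_integrable [OF v(1)]] sq_integrable [OF int]])
    show "m * ((poly P x)\<^sup>2 * v x) \<le> (poly P x)\<^sup>2 * w x" if "x \<in> S" for x
      using mult_left_mono [OF m(2) [OF that], of "(poly P x)\<^sup>2"] by (simp add: mult_ac)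
  qed
  then show "m * sq_int S v P \<le> sq_int S w P" by (simp add: sq_int_def)
  have "sq_int S w P \<le> integral S (\<lambda>x. M * ((poly P x)\<^sup>2 * v x))"
    unfolding sq_int_def
  proof (rule integral_le [OF sq_integrable [OF int] integrable_on_mult_right [OF sq_integrable [OF v(1)]]])
    show "(poly P x)\<^sup>2 * w x \<le> M * ((poly P x)\<^sup>2 * v x)" if "x \<in> S" for x
      using mult_left_mono [OF m(3) [OF that], of "(poly P x)\<^sup>2"] by (simp add: mult_ac)
  qed
  then show "sq_int S w P \<le> M * sq_int S v P" by (simp add: sq_int_def)
qed

text \<open>
  The factor \<open>h\<close> changes each squared norm by a factor between \<open>m\<close> and \<open>M\<close>, so the constant grows by
  \<open>sqrt (M / m)\<close>, uniformly in \<open>h\<close>.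
\<close>

theorem L2_markov_bounded_factor:
  fixes w :: "real \<Rightarrow> real"
  assumes I: "I \<in> sets lebesgue" "I \<noteq> {}" and m: "0 < m" and h: "bounded_factor I m M h"
    and w: "\<And>x. x \<in> I \<Longrightarrow> 0 \<le> w x"
    and int: "poly_integrable I w"
    and K: "\<And>n. 0 \<le> K n"
    and markov: "\<And>n P. 1 \<le> n \<Longrightarrow> degree P \<le> n \<Longrightarrow>
      sq_int I w (pderiv P) \<le> (K n)\<^sup>2 * sq_int I w P"
  shows "L2_markov I (\<lambda>x. h x * w x) (\<lambda>n. sqrt (M / m) * K n)"
  unfolding L2_markov_def
proof (intro allI impI)
  fix n and P :: "real poly"
  assume deg: "degree P \<le> n"
  have hb: "m \<le> h x" "h x \<le> M" if "x \<in> I" for x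
    using h that by (auto simp: bounded_factor_def)
  have M: "0 < M" using I(2) hb m by fastforce
  have wm: "w \<in> borel_measurable (lebesgue_on I)"
    using int [unfolded poly_integrable_def, rule_format, of 1] integrable_imp_measurable by simp
  have hw: "(\<lambda>x. h x * w x) \<in> borel_measurable (lebesgue_on I)"
    using h wm by (intro borel_measurable_times) (auto simp: bounded_factor_def)
  note cmp = comparable_weight [OF I(1) int w hw m, of M]
  have c: "poly_integrable I (\<lambda>x. h x * w x)" "m * sq_int I w Q \<le> sq_int I (\<lambda>x. h x * w x) Q"
    "sq_int I (\<lambda>x. h x * w x) Q \<le> M * sq_int I w Q" for Q
    using cmp hb w by (auto simp: mult_right_mono)
  have sq: "sq_int I w (pderiv P) \<le> (K n)\<^sup>2 * sq_int I w P"
  proof (cases "n = 0")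
    case True
    then have "pderiv P = 0" using deg by (simp add: pderiv_eq_0_iff)
    then show ?thesis using sq_int_nonneg [OF int w] by (simp add: sq_int_def)
  qed (use markov deg in auto)
  have "sq_int I (\<lambda>x. h x * w x) (pderiv P) \<le> M * ((K n)\<^sup>2 * sq_int I w P)"
    using c(3) [of "pderiv P"] mult_left_mono [OF sq, of M] M by linarith
  also have "\<dots> = (M / m * (K n)\<^sup>2) * (m * sq_int I w P)"
    using m by simp
  also have "\<dots> \<le> (M / m * (K n)\<^sup>2) * sq_int I (\<lambda>x. h x * w x) P"
    by (rule mult_left_mono [OF c(2)]) (use m M in auto)
  finally have "sqrt (sq_int I (\<lambda>x. h x * w x) (pderiv P))
      \<le> sqrt (M / m * (K n)\<^sup>2 * sq_int I (\<lambda>x. h x * w x) P)"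
    by (rule real_sqrt_le_mono)
  also have "\<dots> = sqrt (M / m) * K n * sqrt (sq_int I (\<lambda>x. h x * w x) P)"
    using K [of n] by (simp only: real_sqrt_mult real_sqrt_abs abs_of_nonneg)
  finally have "sqrt (sq_int I (\<lambda>x. h x * w x) (pderiv P))
      \<le> sqrt (M / m) * K n * sqrt (sq_int I (\<lambda>x. h x * w x) P)" .
  moreover have "0 \<le> h x * w x" if "x \<in> I" for x
    using hb(1) [OF that] w [OF that] m by simp
  ultimately show "L2_norm_wt I (\<lambda>x. h x * w x) (pderiv P)
      \<le> sqrt (M / m) * K n * L2_norm_wt I (\<lambda>x. h x * w x) P"
    using L2_norm_wt_eq [OF c(1) I(1)] by simp
qed

section \<open>A spectral bound from a Pearson identity\<close>

text \<open>
  Abstraction of \<open>L f = \<integral> f w\<close> for a classical weight: if \<open>p w\<close> vanishes at the ends of the interval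
  and \<open>(p w)' = t w\<close>, then integrating \<open>(f p w)'\<close> gives the identity \<open>pearson\<close>. The polynomials \<open>p\<close>
  and \<open>t\<close> appear through their coefficients so that eigenvalues can be computed.
\<close>

locale pearson_functional =
  fixes L :: "real poly \<Rightarrow> real" and p\<^sub>0 p\<^sub>1 p\<^sub>2 t\<^sub>0 t\<^sub>1 :: real
  assumes add: "L (f + g) = L f + L g"
    and scale: "L (smult c f) = c * L f"
    and square_nonneg: "0 \<le> L (f * f)"
    and pearson: "L ([:p\<^sub>0, p\<^sub>1, p\<^sub>2:] * pderiv f + [:t\<^sub>0, t\<^sub>1:] * f) = 0"
begin

text \<open>
  Minus the diagonal entry of \<open>oper\<close> at the monomial of degree \<open>n\<close> (see \<open>coeff_oper\<close>).
\<close>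

definition eigval :: "nat \<Rightarrow> real" where
  "eigval n = - (p\<^sub>2 * real n * (real n - 1) + t\<^sub>1 * real n)"

definition oper :: "real poly \<Rightarrow> real poly" where
  "oper f = [:p\<^sub>0, p\<^sub>1, p\<^sub>2:] * pderiv (pderiv f) + [:t\<^sub>0, t\<^sub>1:] * pderiv f"

lemma oper_add: "oper (f + g) = oper f + oper g"
  by (simp only: oper_def pderiv_add distrib_left add_ac)

lemma oper_smult: "oper (smult c f) = smult c (oper f)"
  by (simp only: oper_def pderiv_smult mult_smult_right smult_add_right)

text \<open>
  The Pearson identity for \<open>f' g\<close>. The right-hand side is symmetric in \<open>f\<close> and \<open>g\<close>, hence so is \<open>oper\<close>
  with respect to \<open>L\<close>.
\<close>

lemma L_oper: "L (g * oper f) = - L ([:p\<^sub>0, p\<^sub>1, p\<^sub>2:] * pderiv f * pderiv g)"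
proof -
  have "[:p\<^sub>0, p\<^sub>1, p\<^sub>2:] * pderiv (pderiv f * g) + [:t\<^sub>0, t\<^sub>1:] * (pderiv f * g)
      = g * oper f + [:p\<^sub>0, p\<^sub>1, p\<^sub>2:] * pderiv f * pderiv g"
    by (simp only: oper_def pderiv_mult) (simp only: algebra_simps)
  then show ?thesis
    using pearson [of "pderiv f * g"] add by (metis add_eq_0_iff2)
qed

lemma L_oper_symmetric: "L (g * oper f) = L (f * oper g)"
  using L_oper [of g f] L_oper [of f g] by (simp only: mult_ac)

lemma degree_oper: "degree (oper f) \<le> degree f"
  and coeff_oper: "degree f \<le> n \<Longrightarrow> coeff (oper f) n = - eigval n * coeff f n"
proof -
  have c: "coeff (oper f) n = - eigval n * coeff f n" if "degree f \<le> n" for n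
  proof -
    have [simp]: "coeff f (Suc n) = 0" "coeff f (Suc (Suc n)) = 0"
      using that by (auto intro: coeff_eq_0)
    show ?thesis
    proof (cases n)
      case 0
      then show ?thesis using that by (simp add: oper_def coeff_pderiv eigval_def coeff_eq_0)
    next
      case (Suc k)
      then show ?thesis 
        using that by (cases k) (simp_all add: oper_def coeff_pderiv eigval_def coeff_eq_0 algebra_simps)
    qed
  qed
  then show "degree f \<le> n \<Longrightarrow> coeff (oper f) n = - eigval n * coeff f n" .
  show "degree (oper f) \<le> degree f"
    by (rule degree_le) (auto simp: c coeff_eq_0)
qed

end

locale strict_pearson_functional = pearson_functional +
  assumes eigval_less: "j < n \<Longrightarrow> eigval j < eigval n"
begin

text \<open>
  On polynomials of degree less than \<open>n\<close> the operator \<open>oper + eigval n\<close> is triangular with nonzero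
  diagonal entries \<open>eigval n - eigval i\<close>, so it can be inverted by back substitution from the leading
  coefficient.
\<close>

lemma solve_below:
  assumes "j \<le> n" "\<And>i. j \<le> i \<Longrightarrow> coeff r i = 0"
  shows "\<exists>s. (\<forall>i\<ge>j. coeff s i = 0) \<and> oper s + smult (eigval n) s = r"
  using assms
proof (induction j arbitrary: r)
  case 0
  then have "r = 0" by (intro poly_eqI) simp
  then show ?case by (intro exI [of _ 0]) (simp add: oper_def)
next
  case (Suc j)
  define d where "d = eigval n - eigval j"
  have d: "d \<noteq> 0" using eigval_less [of j n] Suc.prems(1) by (simp add: d_def)
  define s where "s = monom (coeff r j / d) j"
  have s: "degree s \<le> j" by (simp add: s_def degree_monom_le)
  define r' where "r' = r - (oper s + smult (eigval n) s)"
  have "coeff r' i = 0" if "j \<le> i" for i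
  proof (cases "i = j")
    case True
    have "coeff (oper s + smult (eigval n) s) j = d * coeff s j"
      using coeff_oper [OF s] by (simp add: d_def algebra_simps)
    also have "\<dots> = coeff r j" using d by (simp add: s_def)
    finally show ?thesis by (simp add: r'_def True)
  next
    case False
    then have "j < i" using that by simp
    then have "coeff (oper s) i = 0" "coeff s i = 0" "coeff r i = 0"
      using s degree_oper [of s] Suc.prems(2) by (auto intro: coeff_eq_0)
    then show ?thesis by (simp add: r'_def)
  qed
  then obtain s' where s': "\<And>i. j \<le> i \<Longrightarrow> coeff s' i = 0" "oper s' + smult (eigval n) s' = r'"
    using Suc.IH [of r'] Suc.prems(1) by auto
  show ?case
  proof (intro exI [of _ "s' + s"] conjI allI impI)
    show "coeff (s' + s) i = 0" if "Suc j \<le> i" for i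
      using s' s that by (simp add: coeff_eq_0)
    show "oper (s' + s) + smult (eigval n) (s' + s) = r"
      using s'(2) by (simp add: oper_add smult_add_right r'_def algebra_simps)
  qed
qed

lemma eigenpolynomial:
  obtains q where "degree q \<le> n" "coeff q n = 1" "oper q + smult (eigval n) q = 0"
proof -
  let ?x = "monom 1 n :: real poly"
  have x: "degree ?x \<le> n" by (simp add: degree_monom_le)
  define r where "r = - (oper ?x + smult (eigval n) ?x)"
  have "coeff r i = 0" if "n \<le> i" for i
  proof (cases "i = n")
    case True
    then show ?thesis using coeff_oper [OF x] by (simp add: r_def)
  next
    case False
    then have "n < i" using that by simp
    then show ?thesis using x degree_oper [of ?x] by (simp add: r_def coeff_eq_0)
  qed
  then obtain s where s: "\<And>i. n \<le> i \<Longrightarrow> coeff s i = 0" "oper s + smult (eigval n) s = r"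
    using solve_below [of n n r] by auto
  show ?thesis
  proof (rule that [of "?x + s"])
    show "degree (?x + s) \<le> n" using s(1) by (intro degree_le) auto
    show "coeff (?x + s) n = 1" using s(1) [of n] by simp
    show "oper (?x + s) + smult (eigval n) (?x + s) = 0"
      using s(2) by (simp add: r_def oper_add smult_add_right algebra_simps)
  qed
qed

text \<open>
  Put \<open>T\<^sub>n = oper + eigval n\<close>; the claim is \<open>L (f T\<^sub>n f) \<ge> 0\<close>. Write \<open>f = v + a q\<close> with the
  eigenpolynomial \<open>q\<close> of degree \<open>n\<close>. Since \<open>T\<^sub>n q = 0\<close> and \<open>T\<^sub>n\<close> is symmetric,
  \<open>L (f T\<^sub>n f) = L (v T\<^sub>n v)\<close>, and \<open>T\<^sub>n\<close> exceeds \<open>T\<^bsub>n-1\<^esub>\<close> by a positive multiple of the identity. So induction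
  on \<open>n\<close> works without an orthogonal basis.
\<close>

theorem bernstein:
  assumes "degree f \<le> n"
  shows "L ([:p\<^sub>0, p\<^sub>1, p\<^sub>2:] * pderiv f * pderiv f) \<le> eigval n * L (f * f)"
proof -
  have "0 \<le> L (f * (oper f + smult (eigval n) f))"
    using assms
  proof (induction n arbitrary: f)
    case 0
    have "oper f = 0" using 0 by (simp add: oper_def pderiv_eq_0_iff [THEN iffD2])
    then have "L (f * (oper f + smult (eigval 0) f)) = eigval 0 * L (f * f)"
      by (simp add: scale)
    then show ?case by (simp add: eigval_def)
  next
    case (Suc n)
    obtain q where q: "degree q \<le> Suc n" "coeff q (Suc n) = 1" "oper q + smult (eigval (Suc n)) q = 0"
      by (rule eigenpolynomial)
    define T where "T f = oper f + smult (eigval (Suc n)) f" for f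
    have T_add: "T (f + g) = T f + T g" and T_smult: "T (smult c f) = smult c (T f)" for f g c
      by (simp_all add: T_def oper_add oper_smult smult_add_right mult.commute)
    have T_sym: "L (g * T f) = L (f * T g)" for f g
      using L_oper_symmetric [of g f] by (simp add: T_def distrib_left add scale mult.commute)
    define a where "a = coeff f (Suc n)"
    define v where "v = f - smult a q"
    have f: "f = v + smult a q" by (simp add: v_def)
    have v: "degree v \<le> n"
    proof (rule degree_le, intro allI impI)
      show "coeff v i = 0" if "n < i" for i
        using that q Suc.prems
        by (cases "i = Suc n") (auto simp: v_def a_def coeff_eq_0)
    qed
    have Tq: "T q = 0" using q by (simp add: T_def)
    have Tf: "T f = T v" using Tq by (simp add: f T_add T_smult)
    have "L (f * T f) = L (v * T v)"
      using T_sym [of f v] by (simp add: Tf T_sym)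
    also have "\<dots> = L (v * (oper v + smult (eigval n) v)) + (eigval (Suc n) - eigval n) * L (v * v)"
      by (simp add: T_def distrib_left add scale left_diff_distrib)
    also have "\<dots> \<ge> 0"
      using Suc.IH [OF v] eigval_less [of n "Suc n"] square_nonneg [of v] by simp
    finally show ?case by (simp add: T_def)
  qed
  then show ?thesis
    using L_oper [of f f] by (simp add: distrib_left add scale)
qed

end

section \<open>Jacobi weights on a compact interval\<close>

text \<open>
  At the endpoints the value is \<open>0\<close> even if the exponent is not positive, since \<open>0 powr \<alpha> = 0\<close>;
  comparisons with other weights are therefore made on the open interval.
\<close>

definition jac :: "real \<Rightarrow> real \<Rightarrow> real \<Rightarrow> real \<Rightarrow> real \<Rightarrow> real" where
  "jac a b \<alpha> \<beta> x = (x - a) powr \<alpha> * (b - x) powr \<beta>"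

lemma jac_nonneg [simp]: "0 \<le> jac a b \<alpha> \<beta> x"
  by (simp add: jac_def)

lemma jac_Suc:
  assumes "x \<in> {a..b}"
  shows "(x - a) * (b - x) * jac a b \<alpha> \<beta> x = jac a b (\<alpha> + 1) (\<beta> + 1) x"
  using assms by (simp add: jac_def powr_mult_base [symmetric] add.commute)

lemma continuous_times_absolutely_integrable:
  fixes g f :: "real \<Rightarrow> real"
  assumes "continuous_on {a..b} g" "f absolutely_integrable_on {a..b}"
  shows "(\<lambda>x. g x * f x) absolutely_integrable_on {a..b}"
  using assms
  by (intro absolutely_integrable_bounded_measurable_product_real continuous_imp_measurable_on_sets_lebesgue
        compact_imp_bounded compact_continuous_image) auto

lemma powr_left_absolutely_integrable:
  fixes a b \<alpha> :: real
  assumes "a < b" "-1 < \<alpha>"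
  shows "(\<lambda>x. (x - a) powr \<alpha>) absolutely_integrable_on {a..b}"
proof -
  have "((\<lambda>x. (x - a) powr \<alpha>) has_integral ((b - a) powr (\<alpha> + 1) / (\<alpha> + 1) - (a - a) powr (\<alpha> + 1) / (\<alpha> + 1))) {a..b}"
  proof (rule fundamental_theorem_of_calculus_interior)
    show "continuous_on {a..b} (\<lambda>x. (x - a) powr (\<alpha> + 1) / (\<alpha> + 1))"
      using assms by (intro continuous_intros continuous_on_powr') auto
    show "((\<lambda>x. (x - a) powr (\<alpha> + 1) / (\<alpha> + 1)) has_vector_derivative (x - a) powr \<alpha>) (at x)"
      if "x \<in> {a<..<b}" for x
      unfolding has_real_derivative_iff_has_vector_derivative [symmetric]
      using that assms by (auto intro!: derivative_eq_intros)
  qed (use assms in simp)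
  then show ?thesis
    by (intro nonnegative_absolutely_integrable_1) (auto simp: integrable_on_def)
qed

lemma powr_right_absolutely_integrable:
  fixes a b \<beta> :: real
  assumes "a < b" "-1 < \<beta>"
  shows "(\<lambda>x. (b - x) powr \<beta>) absolutely_integrable_on {a..b}"
proof -
  have "((\<lambda>x. (b - x) powr \<beta>) has_integral (- ((b - b) powr (\<beta> + 1) / (\<beta> + 1)) - (- ((b - a) powr (\<beta> + 1) / (\<beta> + 1))))) {a..b}"
  proof (rule fundamental_theorem_of_calculus_interior)
    show "continuous_on {a..b} (\<lambda>x. - ((b - x) powr (\<beta> + 1) / (\<beta> + 1)))"
      using assms by (intro continuous_intros continuous_on_powr') auto
    show "((\<lambda>x. - ((b - x) powr (\<beta> + 1) / (\<beta> + 1))) has_vector_derivative (b - x) powr \<beta>) (at x)"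
      if "x \<in> {a<..<b}" for x
      unfolding has_real_derivative_iff_has_vector_derivative [symmetric]
      using that assms by (auto intro!: derivative_eq_intros)
  qed (use assms in simp)
  then show ?thesis
    by (intro nonnegative_absolutely_integrable_1) (auto simp: integrable_on_def)
qed

text \<open>
  The two singularities are separated by \<open>1 = ((b - x) + (x - a)) / (b - a)\<close>: each of the two
  summands is singular at one endpoint only.
\<close>

lemma continuous_times_jac_integrable:
  assumes ab: "a < b" "-1 < \<alpha>" "-1 < \<beta>" and g: "continuous_on {a..b} g"
  shows "(\<lambda>x. g x * jac a b \<alpha> \<beta> x) integrable_on {a..b}"
proof -
  define u where "u x = (g x / (b - a) * (b - x) powr (\<beta> + 1)) * (x - a) powr \<alpha>
      + (g x / (b - a) * (x - a) powr (\<alpha> + 1)) * (b - x) powr \<beta>" for x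
  have "u absolutely_integrable_on {a..b}"
    unfolding u_def using ab
    by (intro set_integral_add continuous_times_absolutely_integrable powr_left_absolutely_integrable
          powr_right_absolutely_integrable continuous_intros g continuous_on_powr') auto
  then have "u integrable_on {a..b}"
    by (rule set_lebesgue_integral_eq_integral)
  moreover have "u x = g x * jac a b \<alpha> \<beta> x" if "x \<in> {a..b}" for x
  proof -
    have *: "(b - x) powr (\<beta> + 1) = (b - x) * (b - x) powr \<beta>" "(x - a) powr (\<alpha> + 1) = (x - a) * (x - a) powr \<alpha>"
      using that by (simp_all add: powr_mult_base add.commute)
    have "u x = g x / (b - a) * ((b - x) + (x - a)) * jac a b \<alpha> \<beta> x"
      unfolding u_def * jac_def by (simp only: distrib_left distrib_right mult_ac)
    then show ?thesis using ab by simp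
  qed
  ultimately show ?thesis
    by (rule integrable_eq)
qed

lemma poly_jac_integrable:
  "a < b \<Longrightarrow> -1 < \<alpha> \<Longrightarrow> -1 < \<beta> \<Longrightarrow> (\<lambda>x. poly f x * jac a b \<alpha> \<beta> x) integrable_on {a..b}"
  by (intro continuous_times_jac_integrable continuous_intros)

definition jac_functional :: "real \<Rightarrow> real \<Rightarrow> real \<Rightarrow> real \<Rightarrow> real poly \<Rightarrow> real" where
  "jac_functional a b \<alpha> \<beta> f = integral {a..b} (\<lambda>x. poly f x * jac a b \<alpha> \<beta> x)"

lemma jac_functional_mono:
  assumes "a < b" "-1 < \<alpha>" "-1 < \<beta>" "\<And>x. x \<in> {a..b} \<Longrightarrow> poly f x \<le> poly g x"
  shows "jac_functional a b \<alpha> \<beta> f \<le> jac_functional a b \<alpha> \<beta> g"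
  unfolding jac_functional_def
  using assms by (intro integral_le poly_jac_integrable mult_right_mono) auto

lemma jac_pearson_functional:
  assumes ab: "a < b" "-1 < \<alpha>" "-1 < \<beta>"
  shows "strict_pearson_functional (jac_functional a b \<alpha> \<beta>) (- a * b) (a + b) (-1)
           ((\<alpha> + 1) * b + (\<beta> + 1) * a) (- (\<alpha> + \<beta> + 2))"
proof -
  interpret pearson_functional "jac_functional a b \<alpha> \<beta>" "- a * b" "a + b" "-1"
    "(\<alpha> + 1) * b + (\<beta> + 1) * a" "- (\<alpha> + \<beta> + 2)"
  proof
    fix f g :: "real poly" and c :: real
    show "jac_functional a b \<alpha> \<beta> (f + g) = jac_functional a b \<alpha> \<beta> f + jac_functional a b \<alpha> \<beta> g"
      unfolding jac_functional_def using ab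
      by (simp add: distrib_right Henstock_Kurzweil_Integration.integral_add poly_jac_integrable)
    show "jac_functional a b \<alpha> \<beta> (smult c f) = c * jac_functional a b \<alpha> \<beta> f"
      unfolding jac_functional_def by (simp add: mult.assoc)
    show "0 \<le> jac_functional a b \<alpha> \<beta> (f * f)"
      unfolding jac_functional_def
      using ab by (intro Henstock_Kurzweil_Integration.integral_nonneg poly_jac_integrable) auto
    let ?h = "[:- a * b, a + b, - 1:] * pderiv f + [:(\<alpha> + 1) * b + (\<beta> + 1) * a, - (\<alpha> + \<beta> + 2):] * f"
    let ?F = "\<lambda>x. poly f x * ((x - a) powr (\<alpha> + 1) * (b - x) powr (\<beta> + 1))"
    have "((\<lambda>x. poly ?h x * jac a b \<alpha> \<beta> x) has_integral (?F b - ?F a)) {a..b}"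
    proof (rule fundamental_theorem_of_calculus_interior)
      show "continuous_on {a..b} ?F"
        using ab by (intro continuous_intros continuous_on_powr') auto
      show "(?F has_vector_derivative poly ?h x * jac a b \<alpha> \<beta> x) (at x)" if x: "x \<in> {a<..<b}" for x
      proof -
        have *: "(b - x) powr (\<beta> + 1) = (b - x) * (b - x) powr \<beta>" "(x - a) powr (\<alpha> + 1) = (x - a) * (x - a) powr \<alpha>"
          using x by (simp_all add: powr_mult_base add.commute)
        have "(?F has_real_derivative
            poly (pderiv f) x * ((x - a) powr (\<alpha> + 1) * (b - x) powr (\<beta> + 1))
            + poly f x * (((\<alpha> + 1) * (x - a) powr \<alpha>) * (b - x) powr (\<beta> + 1)
                + (x - a) powr (\<alpha> + 1) * (- ((\<beta> + 1) * (b - x) powr \<beta>)))) (at x)"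
          using x by (auto intro!: derivative_eq_intros)
        also have "(poly (pderiv f) x * ((x - a) powr (\<alpha> + 1) * (b - x) powr (\<beta> + 1))
            + poly f x * (((\<alpha> + 1) * (x - a) powr \<alpha>) * (b - x) powr (\<beta> + 1)
                + (x - a) powr (\<alpha> + 1) * (- ((\<beta> + 1) * (b - x) powr \<beta>))))
            = poly ?h x * jac a b \<alpha> \<beta> x"
          unfolding * jac_def by (simp add: algebra_simps)
        finally show ?thesis
          by (simp add: has_real_derivative_iff_has_vector_derivative)
      qed
    qed (use ab in simp)
    then show "jac_functional a b \<alpha> \<beta> ?h = 0"
      unfolding jac_functional_def using ab by (simp add: integral_unique)
  qed
  show ?thesis
  proof
    fix j n :: nat
    assume jn: "j < n"
    have "eigval n - eigval j = (real n - real j) * (real n + real j + \<alpha> + \<beta> + 1)"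
      unfolding eigval_def by (simp add: algebra_simps)
    also have "\<dots> > 0"
      using jn ab by (intro mult_pos_pos) auto
    finally show "eigval j < eigval n" by simp
  qed
qed

lemma jac_bernstein:
  assumes ab: "a < b" "-1 < \<alpha>" "-1 < \<beta>" and n: "1 \<le> n" "degree f \<le> n"
  shows "jac_functional a b \<alpha> \<beta> ([:- a * b, a + b, - 1:] * pderiv f * pderiv f)
    \<le> (2 + \<bar>\<alpha> + \<beta>\<bar>) * (real n)\<^sup>2 * jac_functional a b \<alpha> \<beta> (f * f)"
proof -
  interpret strict_pearson_functional "jac_functional a b \<alpha> \<beta>" "- a * b" "a + b" "-1"
    "(\<alpha> + 1) * b + (\<beta> + 1) * a" "- (\<alpha> + \<beta> + 2)"
    using ab by (rule jac_pearson_functional)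
  have "eigval n = (real n)\<^sup>2 + (\<alpha> + \<beta> + 1) * real n"
    unfolding eigval_def by (simp add: algebra_simps power2_eq_square)
  also have "(\<alpha> + \<beta> + 1) * real n \<le> (1 + \<bar>\<alpha> + \<beta>\<bar>) * (real n)\<^sup>2"
    using n by (intro mult_mono) (auto simp: power2_eq_square)
  finally have "eigval n \<le> (2 + \<bar>\<alpha> + \<beta>\<bar>) * (real n)\<^sup>2"
    by (simp add: algebra_simps)
  then show ?thesis
    using bernstein [OF n(2)] mult_right_mono [OF _ square_nonneg [of f]] order_trans by blast
qed

text \<open>
  The pointwise form of the argument for \<open>jac_endpoints\<close>, with \<open>u = x - a\<close>, \<open>v = b - x\<close>, and \<open>A\<close>, \<open>D\<close>
  the values of \<open>Q\<close> and \<open>Q'\<close>. The first summand on the right is \<open>p g' + t g\<close> for \<open>g = (v - u) Q\<^sup>2\<close>,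
  which integrates to \<open>0\<close>. The factor \<open>v - u\<close> makes \<open>t g\<close> positive at both endpoints, where \<open>t\<close> has
  opposite signs; this is what produces the left-hand side, up to multiples of \<open>p = u v\<close>.
\<close>

lemma endpoint_field_inequality:
  fixes u v A D \<epsilon> \<alpha> \<beta> c :: real
  assumes u: "0 \<le> u" "0 \<le> v" and c: "c \<le> \<alpha> + 1" "c \<le> \<beta> + 1" and \<epsilon>: "0 < \<epsilon>"
  shows "c * (u + v)\<^sup>2 * A\<^sup>2
    \<le> (u * v * (- 2 * A\<^sup>2 + 2 * (v - u) * A * D) + ((\<alpha> + 1) * v - (\<beta> + 1) * u) * ((v - u) * A\<^sup>2))
      + (2 * (\<alpha> + \<beta>) + 6 + (u + v)\<^sup>2 / \<epsilon>) * (u * v * A\<^sup>2) + \<epsilon> * (u * v * D\<^sup>2)"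
proof -
  have sq: "(v - u)\<^sup>2 \<le> (u + v)\<^sup>2"
    using u by (simp add: power2_eq_square algebra_simps)
  have "0 \<le> (\<epsilon> * D + (v - u) * A)\<^sup>2 / \<epsilon>"
    using \<epsilon> by simp
  also have "\<dots> = \<epsilon> * D\<^sup>2 + 2 * (v - u) * A * D + (v - u)\<^sup>2 / \<epsilon> * A\<^sup>2"
    using \<epsilon> by (simp add: power2_eq_square field_simps)
  also have "\<dots> \<le> \<epsilon> * D\<^sup>2 + 2 * (v - u) * A * D + (u + v)\<^sup>2 / \<epsilon> * A\<^sup>2"
    using sq \<epsilon> by (intro add_left_mono mult_right_mono divide_right_mono) auto
  finally have "0 \<le> u * v * (\<epsilon> * D\<^sup>2 + 2 * (v - u) * A * D + (u + v)\<^sup>2 / \<epsilon> * A\<^sup>2)"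
    using u by simp
  moreover have "c * (u + v)\<^sup>2 * A\<^sup>2 \<le> ((\<alpha> + 1) * v + (\<beta> + 1) * u) * (u + v) * A\<^sup>2"
  proof -
    have "c * v + c * u \<le> (\<alpha> + 1) * v + (\<beta> + 1) * u"
      using u c by (intro add_mono mult_right_mono) auto
    then have "(c * v + c * u) * (u + v) * A\<^sup>2 \<le> ((\<alpha> + 1) * v + (\<beta> + 1) * u) * (u + v) * A\<^sup>2"
      using u by (intro mult_right_mono) auto
    then show ?thesis by (simp add: power2_eq_square algebra_simps)
  qed
  moreover have "(u * v * (- 2 * A\<^sup>2 + 2 * (v - u) * A * D) + ((\<alpha> + 1) * v - (\<beta> + 1) * u) * ((v - u) * A\<^sup>2))
      + (2 * (\<alpha> + \<beta>) + 6 + (u + v)\<^sup>2 / \<epsilon>) * (u * v * A\<^sup>2) + \<epsilon> * (u * v * D\<^sup>2)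
      = ((\<alpha> + 1) * v + (\<beta> + 1) * u) * (u + v) * A\<^sup>2
        + u * v * (\<epsilon> * D\<^sup>2 + 2 * (v - u) * A * D + (u + v)\<^sup>2 / \<epsilon> * A\<^sup>2)"
  proof -
    define e where "e = (u + v)\<^sup>2 / \<epsilon>"
    show ?thesis unfolding e_def [symmetric] by (simp add: power2_eq_square) algebra
  qed
  ultimately show ?thesis by linarith
qed

text \<open>
  The weight \<open>p = (x - a) (b - x)\<close> may be dropped from the norm of a polynomial of degree \<open>n\<close> for a
  factor \<open>O(n\<^sup>2)\<close>. Let \<open>X\<close>, \<open>Y\<close>, \<open>Z\<close> be the integrals of \<open>Q\<^sup>2\<close>, \<open>p Q\<^sup>2\<close>, \<open>p Q'\<^sup>2\<close>. The field inequality
  gives \<open>c l\<^sup>2 X \<le> (K + l\<^sup>2 / \<epsilon>) Y + \<epsilon> Z\<close>, and \<open>Z = O(n\<^sup>2) X\<close> by \<open>jac_bernstein\<close>. The constant depends on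
  the interval through its length only, which is needed for the sum over unit intervals later.
\<close>

lemma jac_endpoints:
  assumes \<alpha>: "-1 < \<alpha>" "-1 < \<beta>" and l: "0 < l"
  obtains C where "0 \<le> C"
    "\<And>a b n Q. b - a = l \<Longrightarrow> 1 \<le> n \<Longrightarrow> degree Q \<le> n \<Longrightarrow>
       jac_functional a b \<alpha> \<beta> (Q * Q)
         \<le> C * (real n)\<^sup>2 * jac_functional a b \<alpha> \<beta> ([:- a * b, a + b, - 1:] * Q * Q)"
proof -
  define c where "c = min (\<alpha> + 1) (\<beta> + 1)"
  have c: "0 < c" "c \<le> \<alpha> + 1" "c \<le> \<beta> + 1" using \<alpha> by (auto simp: c_def)
  define B where "B = 2 + \<bar>\<alpha> + \<beta>\<bar>"
  have B: "0 < B" by (simp add: B_def)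
  define K where "K = 2 * (\<alpha> + \<beta>) + 6"
  have K: "0 < K" using \<alpha> by (simp add: K_def)
  define C where "C = 2 * (K + 2 * B / c) / (c * l\<^sup>2)"
  show ?thesis
  proof (rule that [of C])
    show "0 \<le> C" using K B c l by (simp add: C_def)
    fix a b :: real and n and Q :: "real poly"
    assume ab: "b - a = l" and n: "1 \<le> n" "degree Q \<le> n"
    then have lt: "a < b" using l by simp
    note abc = lt \<alpha>
    interpret strict_pearson_functional "jac_functional a b \<alpha> \<beta>" "- a * b" "a + b" "-1"
      "(\<alpha> + 1) * b + (\<beta> + 1) * a" "- (\<alpha> + \<beta> + 2)"
      using abc by (rule jac_pearson_functional)
    let ?J = "jac_functional a b \<alpha> \<beta>"
    let ?p = "[:- a * b, a + b, - 1:]"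
    let ?g = "[:a + b, - 2:] * (Q * Q)"
    let ?h = "?p * pderiv ?g + [:(\<alpha> + 1) * b + (\<beta> + 1) * a, - (\<alpha> + \<beta> + 2):] * ?g"
    define X where "X = ?J (Q * Q)"
    define Y where "Y = ?J (?p * Q * Q)"
    define Z where "Z = ?J (?p * pderiv Q * pderiv Q)"
    have Z: "Z \<le> B * (real n)\<^sup>2 * X"
      using jac_bernstein [OF abc n] by (simp add: Z_def B_def X_def)
    have Y: "0 \<le> Y"
    proof -
      have "?J 0 \<le> Y"
        unfolding Y_def
      proof (rule jac_functional_mono [OF abc])
        fix x assume "x \<in> {a..b}"
        then have "0 \<le> (x - a) * (b - x) * (poly Q x)\<^sup>2" by simp
        then show "poly 0 x \<le> poly (?p * Q * Q) x"
          by (simp add: algebra_simps power2_eq_square)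
      qed
      then show ?thesis using scale [of 0 0] by simp
    qed
    \<comment> \<open>This choice of \<open>\<epsilon>\<close> lets half of the left side absorb the derivative term.\<close>
    define \<epsilon> where "\<epsilon> = c * l\<^sup>2 / (2 * B * (real n)\<^sup>2)"
    have \<epsilon>: "0 < \<epsilon>" using c B l n by (simp add: \<epsilon>_def)
    have "?J (smult (c * l\<^sup>2) (Q * Q))
        \<le> ?J (?h + smult (K + l\<^sup>2 / \<epsilon>) (?p * Q * Q) + smult \<epsilon> (?p * pderiv Q * pderiv Q))"
    proof (rule jac_functional_mono [OF abc])
      fix x assume x: "x \<in> {a..b}"
      let ?A = "poly Q x" and ?D = "poly (pderiv Q) x"
      have l': "(x - a) + (b - x) = l" using ab by simp
      have p': "poly ?p x = (x - a) * (b - x)" by (simp add: algebra_simps)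
      have g': "poly ?g x = ((b - x) - (x - a)) * ?A\<^sup>2"
        by (simp add: algebra_simps power2_eq_square)
      have g'': "poly (pderiv ?g) x = - 2 * ?A\<^sup>2 + 2 * ((b - x) - (x - a)) * ?A * ?D"
        unfolding pderiv_mult poly_add poly_mult by (simp add: pderiv_pCons algebra_simps power2_eq_square)
      have t': "poly [:(\<alpha> + 1) * b + (\<beta> + 1) * a, - (\<alpha> + \<beta> + 2):] x = (\<alpha> + 1) * (b - x) - (\<beta> + 1) * (x - a)"
        by (simp add: algebra_simps)
      show "poly (smult (c * l\<^sup>2) (Q * Q)) x \<le> poly (?h + smult (K + l\<^sup>2 / \<epsilon>) (?p * Q * Q) + smult \<epsilon> (?p * pderiv Q * pderiv Q)) x"
        using endpoint_field_inequality [of "x - a" "b - x" c \<alpha> \<beta> \<epsilon> ?A ?D] x c \<epsilon>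
        unfolding l' poly_add poly_mult [of ?p] poly_mult [of "?p * Q"] poly_mult [of "?p * pderiv Q"]
          poly_mult [of "[:(\<alpha> + 1) * b + (\<beta> + 1) * a, - (\<alpha> + \<beta> + 2):]"] poly_smult p' g' g'' t' K_def [symmetric]
        by (simp add: power2_eq_square mult.assoc)
    qed
    also have "?J (smult (c * l\<^sup>2) (Q * Q)) = c * l\<^sup>2 * X"
      by (simp only: scale X_def)
    also have "?J (?h + smult (K + l\<^sup>2 / \<epsilon>) (?p * Q * Q) + smult \<epsilon> (?p * pderiv Q * pderiv Q))
        = (K + l\<^sup>2 / \<epsilon>) * Y + \<epsilon> * Z"
      using pearson [of ?g] by (simp only: add scale Y_def Z_def add_0)
    also have "\<dots> \<le> (K + l\<^sup>2 / \<epsilon>) * Y + \<epsilon> * (B * (real n)\<^sup>2 * X)"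
      using Z \<epsilon> by (intro add_left_mono mult_left_mono) auto
    also have "\<epsilon> * (B * (real n)\<^sup>2 * X) = c * l\<^sup>2 * X / 2"
      using B n by (simp add: \<epsilon>_def field_simps)
    also have "l\<^sup>2 / \<epsilon> = 2 * B / c * (real n)\<^sup>2"
      using B n l c by (simp add: \<epsilon>_def field_simps)
    finally have "c * l\<^sup>2 / 2 * X \<le> (K + 2 * B / c * (real n)\<^sup>2) * Y"
      by (simp add: field_simps)
    also have "\<dots> \<le> (K * (real n)\<^sup>2 + 2 * B / c * (real n)\<^sup>2) * Y"
    proof -
      have "K * 1 \<le> K * (real n)\<^sup>2" using K n by (intro mult_left_mono) auto
      then show ?thesis using Y by (intro mult_right_mono) auto
    qed
    also have "\<dots> = c * l\<^sup>2 / 2 * (C * (real n)\<^sup>2 * Y)"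
      using c l by (simp add: C_def field_simps)
    finally show "X \<le> C * (real n)\<^sup>2 * Y"
      by (rule mult_left_le_imp_le) (use c l in simp)
  qed
qed

text \<open>
  \<open>P'\<close> is bounded in the norm with the additional factor \<open>p\<close> by \<open>jac_bernstein\<close>, and \<open>jac_endpoints\<close>
  for \<open>P'\<close> removes that factor.
\<close>

lemma jac_markov:
  assumes \<alpha>: "-1 < \<alpha>" "-1 < \<beta>" and l: "0 < l"
  obtains C where "0 \<le> C"
    "\<And>a b n P. b - a = l \<Longrightarrow> 1 \<le> n \<Longrightarrow> degree P \<le> n \<Longrightarrow>
       integral {a..b} (\<lambda>x. (poly (pderiv P) x)\<^sup>2 * jac a b \<alpha> \<beta> x)
         \<le> C * ((real n)\<^sup>2)\<^sup>2 * integral {a..b} (\<lambda>x. (poly P x)\<^sup>2 * jac a b \<alpha> \<beta> x)"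
proof -
  obtain C where C: "0 \<le> C" "\<And>a b n Q. b - a = l \<Longrightarrow> 1 \<le> n \<Longrightarrow> degree Q \<le> n \<Longrightarrow>
       jac_functional a b \<alpha> \<beta> (Q * Q)
         \<le> C * (real n)\<^sup>2 * jac_functional a b \<alpha> \<beta> ([:- a * b, a + b, - 1:] * Q * Q)"
    using jac_endpoints [OF assms] by metis
  show ?thesis
  proof (rule that [of "C * (2 + \<bar>\<alpha> + \<beta>\<bar>)"])
    show "0 \<le> C * (2 + \<bar>\<alpha> + \<beta>\<bar>)" using C by simp
    fix a b :: real and n and P :: "real poly"
    assume ab: "b - a = l" and n: "1 \<le> n" "degree P \<le> n"
    then have lt: "a < b" using l by simp
    have deg: "degree (pderiv P) \<le> n" using n by (simp add: degree_pderiv)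
    have "jac_functional a b \<alpha> \<beta> (pderiv P * pderiv P)
        \<le> C * (real n)\<^sup>2 * jac_functional a b \<alpha> \<beta> ([:- a * b, a + b, - 1:] * pderiv P * pderiv P)"
      using C(2) [OF ab n(1) deg] .
    also have "\<dots> \<le> C * (real n)\<^sup>2 * ((2 + \<bar>\<alpha> + \<beta>\<bar>) * (real n)\<^sup>2 * jac_functional a b \<alpha> \<beta> (P * P))"
      using jac_bernstein [OF lt \<alpha> n] C(1) by (intro mult_left_mono) auto
    finally show "integral {a..b} (\<lambda>x. (poly (pderiv P) x)\<^sup>2 * jac a b \<alpha> \<beta> x)
         \<le> C * (2 + \<bar>\<alpha> + \<beta>\<bar>) * ((real n)\<^sup>2)\<^sup>2 * integral {a..b} (\<lambda>x. (poly P x)\<^sup>2 * jac a b \<alpha> \<beta> x)"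
      by (simp add: jac_functional_def power2_eq_square mult_ac)
  qed
qed

text \<open>
  Each application of \<open>jac_endpoints\<close> raises both exponents of the weight by one.
\<close>

lemma jac_nikolskii:
  assumes l: "0 < l"
  obtains C where "0 \<le> C"
    "\<And>a b n Q. b - a = l \<Longrightarrow> 1 \<le> n \<Longrightarrow> degree Q \<le> n \<Longrightarrow>
       integral {a..b} (\<lambda>x. (poly Q x)\<^sup>2)
         \<le> C * (real n) ^ (2 * k) * integral {a..b} (\<lambda>x. (poly Q x)\<^sup>2 * jac a b (real k) (real k) x)"
proof -
  have "\<exists>C\<ge>0. \<forall>a b n Q. b - a = l \<longrightarrow> 1 \<le> n \<longrightarrow> degree Q \<le> n \<longrightarrow>
       integral {a..b} (\<lambda>x. (poly Q x)\<^sup>2)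
         \<le> C * (real n) ^ (2 * k) * integral {a..b} (\<lambda>x. (poly Q x)\<^sup>2 * jac a b (real k) (real k) x)"
  proof (induction k)
    case 0
    have "integral {a..b} (\<lambda>x. (poly Q x)\<^sup>2) = integral {a..b} (\<lambda>x. (poly Q x)\<^sup>2 * jac a b 0 0 x)" for a b :: real and Q
      by (rule integral_spike [of "{a, b}"]) (auto simp: jac_def)
    then show ?case by (intro exI [of _ 1]) simp
  next
    case (Suc k)
    then obtain C where C: "0 \<le> C" "\<And>a b n Q. b - a = l \<Longrightarrow> 1 \<le> n \<Longrightarrow> degree Q \<le> n \<Longrightarrow>
       integral {a..b} (\<lambda>x. (poly Q x)\<^sup>2)
         \<le> C * (real n) ^ (2 * k) * integral {a..b} (\<lambda>x. (poly Q x)\<^sup>2 * jac a b (real k) (real k) x)"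
      by blast
    have k: "-1 < real k" by simp
    obtain D where D: "0 \<le> D" "\<And>a b n Q. b - a = l \<Longrightarrow> 1 \<le> n \<Longrightarrow> degree Q \<le> n \<Longrightarrow>
       jac_functional a b (real k) (real k) (Q * Q)
         \<le> D * (real n)\<^sup>2 * jac_functional a b (real k) (real k) ([:- a * b, a + b, - 1:] * Q * Q)"
      using jac_endpoints [OF k k l] by metis
    show ?case
    proof (intro exI [of _ "C * D"] conjI allI impI)
      show "0 \<le> C * D" using C D by simp
      fix a b :: real and n and Q :: "real poly"
      assume ab: "b - a = l" and n: "1 \<le> n" "degree Q \<le> n"
      have "integral {a..b} (\<lambda>x. (poly Q x)\<^sup>2)
          \<le> C * (real n) ^ (2 * k) * integral {a..b} (\<lambda>x. (poly Q x)\<^sup>2 * jac a b (real k) (real k) x)"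
        using C(2) [OF ab n] .
      also have "\<dots> = C * (real n) ^ (2 * k) * jac_functional a b (real k) (real k) (Q * Q)"
        by (simp add: jac_functional_def power2_eq_square)
      also have "\<dots> \<le> C * (real n) ^ (2 * k) * (D * (real n)\<^sup>2 * jac_functional a b (real k) (real k) ([:- a * b, a + b, - 1:] * Q * Q))"
        using C(1) D(2) [OF ab n] by (intro mult_left_mono) auto
      also have "jac_functional a b (real k) (real k) ([:- a * b, a + b, - 1:] * Q * Q)
          = integral {a..b} (\<lambda>x. (poly Q x)\<^sup>2 * jac a b (real (Suc k)) (real (Suc k)) x)"
        unfolding jac_functional_def
      proof (rule Henstock_Kurzweil_Integration.integral_cong)
        fix x assume x: "x \<in> {a..b}"
        have "poly ([:- a * b, a + b, - 1:] * Q * Q) x = (x - a) * (b - x) * (poly Q x)\<^sup>2"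
          by (simp add: algebra_simps power2_eq_square)
        then show "poly ([:- a * b, a + b, - 1:] * Q * Q) x * jac a b (real k) (real k) x
            = (poly Q x)\<^sup>2 * jac a b (real (Suc k)) (real (Suc k)) x"
          using jac_Suc [OF x, of "real k" "real k"] by (simp add: mult_ac add.commute)
      qed
      finally show "integral {a..b} (\<lambda>x. (poly Q x)\<^sup>2) \<le> C * D * (real n) ^ (2 * Suc k)
          * integral {a..b} (\<lambda>x. (poly Q x)\<^sup>2 * jac a b (real (Suc k)) (real (Suc k)) x)"
        by (simp only: power2_eq_square mult_Suc_right power_add) (simp only: mult_ac)
    qed
  qed
  then show ?thesis using that by blast
qed

section \<open>Generalized Jacobi weights\<close>

text \<open>
  Two inequalities that are proved by the same reduction to Jacobi weights. The second one, a
  comparison with the unweighted norm, serves to exchange weights in the Hermite case.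
\<close>

definition markov_nikolskii :: "nat \<Rightarrow> real set \<Rightarrow> (real \<Rightarrow> real) \<Rightarrow> real \<Rightarrow> bool" where
  "markov_nikolskii k S w C \<longleftrightarrow>
     (\<forall>n P. 1 \<le> n \<longrightarrow> degree P \<le> n \<longrightarrow>
        sq_int S w (pderiv P) \<le> C * ((real n)\<^sup>2)\<^sup>2 * sq_int S w P \<and>
        sq_int S (\<lambda>_. 1) P \<le> C * real n ^ (2 * k) * sq_int S w P)"

lemma poly_integrable_open_interval:
  fixes a b :: real
  shows "poly_integrable {a<..<b} w \<longleftrightarrow> poly_integrable {a..b} w"
  by (simp add: poly_integrable_def integrable_on_open_interval_real)

lemma sq_int_open_interval: "sq_int {a<..<b} w P = sq_int {a..b} w P"
  by (simp add: sq_int_def integral_open_interval_real)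

lemma poly_integrable_jac:
  "a < b \<Longrightarrow> -1 < \<alpha> \<Longrightarrow> -1 < \<beta> \<Longrightarrow> poly_integrable {a..b} (jac a b \<alpha> \<beta>)"
  by (simp add: poly_integrable_def poly_jac_integrable)

lemma markov_nikolskii_comparable:
  assumes S: "S \<in> sets lebesgue" and v: "poly_integrable S v" "\<And>x. x \<in> S \<Longrightarrow> 0 \<le> v x"
    and w: "w \<in> borel_measurable (lebesgue_on S)"
    and m: "0 < m" "\<And>x. x \<in> S \<Longrightarrow> m * v x \<le> w x" "\<And>x. x \<in> S \<Longrightarrow> w x \<le> M * v x" "0 \<le> M"
    and C: "0 \<le> C" "markov_nikolskii k S v C"
  shows "markov_nikolskii k S w (C * (M + 1) / m)"
  unfolding markov_nikolskii_def
proof (intro allI impI)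
  fix n and P :: "real poly"
  assume n: "1 \<le> n" "degree P \<le> n"
  note cmp = comparable_weight [OF S v w m(1-3)]
  have low: "sq_int S v P \<le> sq_int S w P / m"
    using cmp(2) [of P] m(1) by (simp add: field_simps)
  have w0: "0 \<le> sq_int S w P"
    using mult_nonneg_nonneg [OF less_imp_le [OF m(1)] sq_int_nonneg [OF v, of P]] cmp(2) [of P]
    by (rule order_trans)
  have "sq_int S w (pderiv P) \<le> M * (C * ((real n)\<^sup>2)\<^sup>2 * (sq_int S w P / m))"
  proof -
    have "sq_int S w (pderiv P) \<le> M * sq_int S v (pderiv P)"
      by (rule cmp(3))
    also have "\<dots> \<le> M * (C * ((real n)\<^sup>2)\<^sup>2 * sq_int S v P)"
      using C n m(4) unfolding markov_nikolskii_def by (intro mult_left_mono) auto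
    also have "\<dots> \<le> M * (C * ((real n)\<^sup>2)\<^sup>2 * (sq_int S w P / m))"
      using low C m(4) by (intro mult_left_mono) auto
    finally show ?thesis .
  qed
  also have "\<dots> \<le> (M + 1) * (C * ((real n)\<^sup>2)\<^sup>2 * (sq_int S w P / m))"
    using w0 C m by (intro mult_right_mono) auto
  also have "\<dots> = C * (M + 1) / m * ((real n)\<^sup>2)\<^sup>2 * sq_int S w P"
    by simp
  finally have 1: "sq_int S w (pderiv P) \<le> C * (M + 1) / m * ((real n)\<^sup>2)\<^sup>2 * sq_int S w P" .
  have "sq_int S (\<lambda>_. 1) P \<le> C * real n ^ (2 * k) * (sq_int S w P / m)"
  proof -
    have "sq_int S (\<lambda>_. 1) P \<le> C * real n ^ (2 * k) * sq_int S v P"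
      using C n unfolding markov_nikolskii_def by blast
    also have "\<dots> \<le> C * real n ^ (2 * k) * (sq_int S w P / m)"
      using low C by (intro mult_left_mono) auto
    finally show ?thesis .
  qed
  also have "\<dots> = 1 * (C * real n ^ (2 * k) * (sq_int S w P / m))"
    by simp
  also have "\<dots> \<le> (M + 1) * (C * real n ^ (2 * k) * (sq_int S w P / m))"
    using w0 C m by (intro mult_right_mono) auto
  also have "\<dots> = C * (M + 1) / m * real n ^ (2 * k) * sq_int S w P"
    by simp
  finally show "sq_int S w (pderiv P) \<le> C * (M + 1) / m * ((real n)\<^sup>2)\<^sup>2 * sq_int S w P \<and>
      sq_int S (\<lambda>_. 1) P \<le> C * (M + 1) / m * real n ^ (2 * k) * sq_int S w P"
    using 1 by blast
qed

text \<open>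
  The condition on \<open>k\<close> makes the weight with both exponents equal to \<open>k\<close>, which is the one produced by
  \<open>jac_nikolskii\<close>, bounded by a multiple of the given one.
\<close>

lemma markov_nikolskii_jac:
  assumes ab: "a < b" and \<alpha>: "-1 < \<alpha>" "-1 < \<beta>" "\<alpha> \<le> real k" "\<beta> \<le> real k"
  obtains C where "0 \<le> C" "markov_nikolskii k {a..b} (jac a b \<alpha> \<beta>) C"
proof -
  have l: "0 < b - a" using ab by simp
  obtain C where C: "0 \<le> C" "\<And>n P. 1 \<le> n \<Longrightarrow> degree P \<le> n \<Longrightarrow>
      sq_int {a..b} (jac a b \<alpha> \<beta>) (pderiv P) \<le> C * ((real n)\<^sup>2)\<^sup>2 * sq_int {a..b} (jac a b \<alpha> \<beta>) P"
    unfolding sq_int_def by (rule jac_markov [OF \<alpha>(1,2) l]) blast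
  obtain D where D: "0 \<le> D" "\<And>n P. 1 \<le> n \<Longrightarrow> degree P \<le> n \<Longrightarrow>
      sq_int {a..b} (\<lambda>_. 1) P \<le> D * real n ^ (2 * k) * sq_int {a..b} (jac a b (real k) (real k)) P"
    unfolding sq_int_def mult_1_right by (rule jac_nikolskii [OF l, of k]) blast
  define E where "E = (b - a) powr (real k - \<alpha>) * (b - a) powr (real k - \<beta>)"
  have E: "jac a b (real k) (real k) x \<le> E * jac a b \<alpha> \<beta> x" if x: "x \<in> {a..b}" for x
  proof -
    have "(x - a) powr real k = (x - a) powr (real k - \<alpha>) * (x - a) powr \<alpha>"
      by (simp flip: powr_add)
    also have "\<dots> \<le> (b - a) powr (real k - \<alpha>) * (x - a) powr \<alpha>"
      using x \<alpha> by (intro mult_right_mono powr_mono2) auto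
    finally have 1: "(x - a) powr real k \<le> (b - a) powr (real k - \<alpha>) * (x - a) powr \<alpha>" .
    have "(b - x) powr real k = (b - x) powr (real k - \<beta>) * (b - x) powr \<beta>"
      by (simp flip: powr_add)
    also have "\<dots> \<le> (b - a) powr (real k - \<beta>) * (b - x) powr \<beta>"
      using x \<alpha> by (intro mult_right_mono powr_mono2) auto
    finally have "(b - x) powr real k \<le> (b - a) powr (real k - \<beta>) * (b - x) powr \<beta>" .
    from mult_mono [OF 1 this] show ?thesis
      by (simp add: jac_def E_def mult_ac)
  qed
  have E0: "0 \<le> E" by (simp add: E_def)
  have pk: "poly_integrable {a..b} (jac a b (real k) (real k))"
    using ab by (intro poly_integrable_jac) auto
  have p: "poly_integrable {a..b} (jac a b \<alpha> \<beta>)"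
    using ab \<alpha> by (intro poly_integrable_jac) auto
  have le: "sq_int {a..b} (jac a b (real k) (real k)) P \<le> E * sq_int {a..b} (jac a b \<alpha> \<beta>) P" for P
  proof -
    have "sq_int {a..b} (jac a b (real k) (real k)) P \<le> integral {a..b} (\<lambda>x. E * ((poly P x)\<^sup>2 * jac a b \<alpha> \<beta> x))"
      unfolding sq_int_def
    proof (rule integral_le [OF sq_integrable [OF pk] integrable_on_mult_right [OF sq_integrable [OF p]]])
      show "(poly P x)\<^sup>2 * jac a b (real k) (real k) x \<le> E * ((poly P x)\<^sup>2 * jac a b \<alpha> \<beta> x)" if "x \<in> {a..b}" for x
        using mult_left_mono [OF E [OF that], of "(poly P x)\<^sup>2"] by (simp add: mult_ac)
    qed
    then show ?thesis by (simp add: sq_int_def)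
  qed
  show ?thesis
  proof (rule that [of "C + D * E"])
    show "0 \<le> C + D * E" using C D E0 by simp
    show "markov_nikolskii k {a..b} (jac a b \<alpha> \<beta>) (C + D * E)"
      unfolding markov_nikolskii_def
    proof (intro allI impI conjI)
      fix n and P :: "real poly"
      assume n: "1 \<le> n" "degree P \<le> n"
      have P0: "0 \<le> sq_int {a..b} (jac a b \<alpha> \<beta>) P"
        by (rule sq_int_nonneg [OF p]) simp
      have DE: "0 \<le> D * E" using D E0 by simp
      show "sq_int {a..b} (jac a b \<alpha> \<beta>) (pderiv P) \<le> (C + D * E) * ((real n)\<^sup>2)\<^sup>2 * sq_int {a..b} (jac a b \<alpha> \<beta>) P"
        by (rule order_trans [OF C(2) [OF n]]) (use P0 DE in \<open>intro mult_right_mono, auto\<close>)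
      have "sq_int {a..b} (\<lambda>_. 1) P \<le> D * real n ^ (2 * k) * (E * sq_int {a..b} (jac a b \<alpha> \<beta>) P)"
        by (rule order_trans [OF D(2) [OF n]]) (use le D in \<open>intro mult_left_mono, auto\<close>)
      also have "\<dots> = (D * E) * real n ^ (2 * k) * sq_int {a..b} (jac a b \<alpha> \<beta>) P"
        by simp
      also have "\<dots> \<le> (C + D * E) * real n ^ (2 * k) * sq_int {a..b} (jac a b \<alpha> \<beta>) P"
        using P0 C by (intro mult_right_mono) auto
      finally show "sq_int {a..b} (\<lambda>_. 1) P \<le> (C + D * E) * real n ^ (2 * k) * sq_int {a..b} (jac a b \<alpha> \<beta>) P" .
    qed
  qed
qed

lemma power_prod_nonneg [simp]: "0 \<le> power_prod r c \<gamma> x"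
  by (simp add: power_prod_def prod_nonneg)

lemma power_prod_measurable [measurable]: "power_prod r c \<gamma> \<in> borel_measurable borel"
  unfolding power_prod_def by measurable

lemma borel_imp_lebesgue_on_measurable:
  fixes f :: "real \<Rightarrow> real"
  shows "f \<in> borel_measurable borel \<Longrightarrow> f \<in> borel_measurable (lebesgue_on S)"
  by (intro measurable_restrict_space1 measurable_completion) simp

lemma sq_int_combine:
  assumes "a \<le> t" "t \<le> b" "poly_integrable {a..b} w"
  shows "sq_int {a..b} w P = sq_int {a..t} w P + sq_int {t..b} w P"
  unfolding sq_int_def
  using Henstock_Kurzweil_Integration.integral_combine [OF assms(1,2) sq_integrable [OF assms(3)]] by simp

lemma poly_integrable_combine:
  fixes a b t :: real
  assumes "a \<le> t" "t \<le> b" "poly_integrable {a..t} w" "poly_integrable {t..b} w"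
  shows "poly_integrable {a..b} w"
  using assms Henstock_Kurzweil_Integration.integrable_combine unfolding poly_integrable_def by blast

lemma poly_integrable_1: "poly_integrable {a..b} (\<lambda>_. 1)"
  unfolding poly_integrable_def
  by (intro allI integrable_continuous_interval continuous_intros)

text \<open>
  Without a \<open>c\<^sub>j\<close> in the open interval, the factors with \<open>c\<^sub>j = a\<close> and \<open>c\<^sub>j = b\<close> make up a Jacobi weight, and
  the product \<open>g\<close> of the other factors is continuous and positive on \<open>[a, b]\<close>. Several \<open>c\<^sub>j\<close> may
  coincide, so their exponents are added.
\<close>

lemma generalized_jacobi_piece:
  assumes ab: "a < b" and c: "\<And>j. j \<in> {1..r} \<Longrightarrow> c j \<notin> {a<..<b}"
    and \<gamma>: "\<And>x. x \<in> {a..b} \<Longrightarrow> -1 < (\<Sum>j\<in>{j\<in>{1..r}. c j = x}. \<gamma> j)"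
      "\<And>x. x \<in> {a..b} \<Longrightarrow> (\<Sum>j\<in>{j\<in>{1..r}. c j = x}. \<gamma> j) \<le> real k"
  shows "poly_integrable {a..b} (power_prod r c \<gamma>) \<and>
    (\<exists>C\<ge>0. markov_nikolskii k {a..b} (power_prod r c \<gamma>) C)"
proof -
  define A where "A = {j\<in>{1..r}. c j = a}"
  define B where "B = {j\<in>{1..r}. c j = b}"
  define D where "D = {j\<in>{1..r}. c j \<noteq> a \<and> c j \<noteq> b}"
  define \<alpha> where "\<alpha> = sum \<gamma> A"
  define \<beta> where "\<beta> = sum \<gamma> B"
  define g where "g x = (\<Prod>j\<in>D. \<bar>x - c j\<bar> powr \<gamma> j)" for x
  have \<alpha>: "-1 < \<alpha>" "-1 < \<beta>" "\<alpha> \<le> real k" "\<beta> \<le> real k"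
    using \<gamma> [of a] \<gamma> [of b] ab by (auto simp: \<alpha>_def \<beta>_def A_def B_def)
  have eq: "power_prod r c \<gamma> x = g x * jac a b \<alpha> \<beta> x" if x: "x \<in> {a<..<b}" for x
  proof -
    have fin: "finite A" "finite B" "finite D" "A \<inter> B = {}" "(A \<union> B) \<inter> D = {}"
      using ab by (auto simp: A_def B_def D_def)
    have "{1..r} = (A \<union> B) \<union> D" by (auto simp: A_def B_def D_def)
    then have "power_prod r c \<gamma> x = (\<Prod>j\<in>A. \<bar>x - c j\<bar> powr \<gamma> j) * (\<Prod>j\<in>B. \<bar>x - c j\<bar> powr \<gamma> j) * g x"
      unfolding power_prod_def g_def using fin by (simp add: prod.union_disjoint)
    also have "(\<Prod>j\<in>A. \<bar>x - c j\<bar> powr \<gamma> j) = (\<Prod>j\<in>A. (x - a) powr \<gamma> j)"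
      using x by (intro prod.cong) (auto simp: A_def)
    also have "\<dots> = (x - a) powr \<alpha>"
      using x by (simp add: \<alpha>_def powr_sum A_def)
    also have "(\<Prod>j\<in>B. \<bar>x - c j\<bar> powr \<gamma> j) = (\<Prod>j\<in>B. (b - x) powr \<gamma> j)"
      using x by (intro prod.cong) (auto simp: B_def)
    also have "\<dots> = (b - x) powr \<beta>"
      using x by (simp add: \<beta>_def powr_sum B_def)
    finally show ?thesis by (simp add: jac_def)
  qed
  have ne: "x - c j \<noteq> 0" if "x \<in> {a..b}" "j \<in> D" for x j
    using that c [of j] by (auto simp: D_def)
  have cont: "continuous_on {a..b} g"
    unfolding g_def using ne by (intro continuous_intros) auto
  have pos: "0 < g x" if "x \<in> {a..b}" for x
    unfolding g_def using ne that by (intro prod_pos) auto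
  obtain y where y: "y \<in> {a..b}" "\<And>x. x \<in> {a..b} \<Longrightarrow> g y \<le> g x"
    using continuous_attains_inf [OF _ _ cont] ab by fastforce
  obtain z where z: "z \<in> {a..b}" "\<And>x. x \<in> {a..b} \<Longrightarrow> g x \<le> g z"
    using continuous_attains_sup [OF _ _ cont] ab by fastforce
  obtain C where C: "0 \<le> C" "markov_nikolskii k {a..b} (jac a b \<alpha> \<beta>) C"
    using markov_nikolskii_jac [OF ab \<alpha>] by metis
  have lo: "g y * jac a b \<alpha> \<beta> x \<le> power_prod r c \<gamma> x" if "x \<in> {a<..<b}" for x
    unfolding eq [OF that] using that y by (intro mult_right_mono) auto
  have up: "power_prod r c \<gamma> x \<le> g z * jac a b \<alpha> \<beta> x" if "x \<in> {a<..<b}" for x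
    unfolding eq [OF that] using that z by (intro mult_right_mono) auto
  have S: "{a<..<b} \<in> sets lebesgue" by simp
  have int: "poly_integrable {a<..<b} (jac a b \<alpha> \<beta>)"
    using ab \<alpha> by (simp add: poly_integrable_open_interval poly_integrable_jac)
  have meas: "power_prod r c \<gamma> \<in> borel_measurable (lebesgue_on {a<..<b})"
    by (intro borel_imp_lebesgue_on_measurable power_prod_measurable)
  have C': "markov_nikolskii k {a<..<b} (jac a b \<alpha> \<beta>) C"
    using C(2) by (simp add: markov_nikolskii_def sq_int_open_interval)
  show ?thesis
  proof (intro conjI exI [of _ "C * (g z + 1) / g y"])
    show "0 \<le> C * (g z + 1) / g y"
      using C pos [OF y(1)] pos [OF z(1)] by simp
    have "markov_nikolskii k {a<..<b} (power_prod r c \<gamma>) (C * (g z + 1) / g y)"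
      using pos [OF y(1)] pos [OF z(1)]
      by (intro markov_nikolskii_comparable [OF S int _ meas _ lo up _ C(1) C']) auto
    then show "markov_nikolskii k {a..b} (power_prod r c \<gamma>) (C * (g z + 1) / g y)"
      by (simp add: markov_nikolskii_def sq_int_open_interval)
    have "poly_integrable {a<..<b} (power_prod r c \<gamma>)"
      using comparable_weight(1) [OF S int _ meas pos [OF y(1)] lo up] by simp
    then show "poly_integrable {a..b} (power_prod r c \<gamma>)"
      by (simp add: poly_integrable_open_interval)
  qed
qed

lemma markov_nikolskii_combine:
  assumes t: "a \<le> t" "t \<le> b" and w: "\<And>x. 0 \<le> w x"
    and int: "poly_integrable {a..t} w" "poly_integrable {t..b} w"
    and C: "markov_nikolskii k {a..t} w C" "markov_nikolskii k {t..b} w C"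
  shows "markov_nikolskii k {a..b} w C"
  unfolding markov_nikolskii_def
proof (intro allI impI)
  fix n and P :: "real poly"
  assume n: "1 \<le> n" "degree P \<le> n"
  note split = sq_int_combine [OF t poly_integrable_combine [OF t int]]
    sq_int_combine [OF t poly_integrable_1]
  have "sq_int {a..t} w (pderiv P) + sq_int {t..b} w (pderiv P)
      \<le> C * ((real n)\<^sup>2)\<^sup>2 * sq_int {a..t} w P + C * ((real n)\<^sup>2)\<^sup>2 * sq_int {t..b} w P"
    "sq_int {a..t} (\<lambda>_. 1) P + sq_int {t..b} (\<lambda>_. 1) P
      \<le> C * real n ^ (2 * k) * sq_int {a..t} w P + C * real n ^ (2 * k) * sq_int {t..b} w P"
    using C n unfolding markov_nikolskii_def by (auto intro!: add_mono)
  then show "sq_int {a..b} w (pderiv P) \<le> C * ((real n)\<^sup>2)\<^sup>2 * sq_int {a..b} w P \<and>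
      sq_int {a..b} (\<lambda>_. 1) P \<le> C * real n ^ (2 * k) * sq_int {a..b} w P"
    by (simp add: split distrib_left)
qed

lemma markov_nikolskii_mono:
  assumes "markov_nikolskii k S w C" "C \<le> D" "poly_integrable S w" "\<And>x. x \<in> S \<Longrightarrow> 0 \<le> w x"
  shows "markov_nikolskii k S w D"
  unfolding markov_nikolskii_def
proof (intro allI impI)
  fix n and P :: "real poly"
  assume n: "1 \<le> n" "degree P \<le> n"
  have "0 \<le> sq_int S w P" using assms(3,4) by (rule sq_int_nonneg)
  then have "C * ((real n)\<^sup>2)\<^sup>2 * sq_int S w P \<le> D * ((real n)\<^sup>2)\<^sup>2 * sq_int S w P"
      "C * real n ^ (2 * k) * sq_int S w P \<le> D * real n ^ (2 * k) * sq_int S w P"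
    using assms(2) by (auto intro!: mult_right_mono)
  then show "sq_int S w (pderiv P) \<le> D * ((real n)\<^sup>2)\<^sup>2 * sq_int S w P \<and>
      sq_int S (\<lambda>_. 1) P \<le> D * real n ^ (2 * k) * sq_int S w P"
    using assms(1) n unfolding markov_nikolskii_def by (meson order_trans)
qed

text \<open>
  Induction on the number of indices \<open>j\<close> with \<open>c\<^sub>j\<close> inside the interval, splitting at one such point.
\<close>

theorem generalized_jacobi:
  fixes a b :: real
  assumes "a < b"
    and "\<And>x. x \<in> {a..b} \<Longrightarrow> -1 < (\<Sum>j\<in>{j\<in>{1..r}. c j = x}. \<gamma> j)"
      "\<And>x. x \<in> {a..b} \<Longrightarrow> (\<Sum>j\<in>{j\<in>{1..r}. c j = x}. \<gamma> j) \<le> real k"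
  shows "poly_integrable {a..b} (power_prod r c \<gamma>) \<and>
    (\<exists>C\<ge>0. markov_nikolskii k {a..b} (power_prod r c \<gamma>) C)"
  using assms
proof (induction "card {j \<in> {1..r}. c j \<in> {a<..<b}}" arbitrary: a b rule: less_induct)
  case less
  show ?case
  proof (cases "\<exists>i\<in>{1..r}. c i \<in> {a<..<b}")
    case False
    show ?thesis
    proof (rule generalized_jacobi_piece [of a b r c \<gamma> k])
      show "c j \<notin> {a<..<b}" if "j \<in> {1..r}" for j
        using False that by blast
    qed (fact less.prems)+
  next
    case True
    then obtain i where i: "i \<in> {1..r}" "a < c i" "c i < b" by auto
    have "poly_integrable {a..c i} (power_prod r c \<gamma>) \<and> (\<exists>C\<ge>0. markov_nikolskii k {a..c i} (power_prod r c \<gamma>) C)"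
    proof (rule less.hyps)
      show "card {j \<in> {1..r}. c j \<in> {a<..<c i}} < card {j \<in> {1..r}. c j \<in> {a<..<b}}"
        using i by (intro psubset_card_mono) auto
    qed (use i less.prems in auto)
    moreover have "poly_integrable {c i..b} (power_prod r c \<gamma>) \<and> (\<exists>C\<ge>0. markov_nikolskii k {c i..b} (power_prod r c \<gamma>) C)"
    proof (rule less.hyps)
      show "card {j \<in> {1..r}. c j \<in> {c i<..<b}} < card {j \<in> {1..r}. c j \<in> {a<..<b}}"
        using i by (intro psubset_card_mono) auto
    qed (use i less.prems in auto)
    ultimately obtain C D where C: "0 \<le> C" "0 \<le> D"
      "markov_nikolskii k {a..c i} (power_prod r c \<gamma>) C" "markov_nikolskii k {c i..b} (power_prod r c \<gamma>) D"
      and int: "poly_integrable {a..c i} (power_prod r c \<gamma>)" "poly_integrable {c i..b} (power_prod r c \<gamma>)"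
      by blast
    have "markov_nikolskii k {a..c i} (power_prod r c \<gamma>) (max C D)"
      by (rule markov_nikolskii_mono [OF C(3) _ int(1)]) auto
    moreover have "markov_nikolskii k {c i..b} (power_prod r c \<gamma>) (max C D)"
      by (rule markov_nikolskii_mono [OF C(4) _ int(2)]) auto
    ultimately have "markov_nikolskii k {a..b} (power_prod r c \<gamma>) (max C D)"
      using i by (intro markov_nikolskii_combine [OF _ _ _ int]) auto
    moreover have "poly_integrable {a..b} (power_prod r c \<gamma>)"
      using i by (intro poly_integrable_combine [OF _ _ int]) auto
    moreover have "0 \<le> max C D" using C by simp
    ultimately show ?thesis by blast
  qed
qed

section \<open>Generalized Laguerre weights\<close>

lemma poly_exp_bound:
  fixes f :: "real poly"
  shows "0 < \<epsilon> \<Longrightarrow> \<exists>C. \<forall>x. \<bar>poly f x\<bar> \<le> C * exp (\<epsilon> * \<bar>x\<bar>)"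
proof (induction f arbitrary: \<epsilon>)
  case 0
  then show ?case by (intro exI [of _ 0]) simp
next
  case (pCons a f)
  obtain C where C: "\<And>x. \<bar>poly f x\<bar> \<le> C * exp (\<epsilon> / 2 * \<bar>x\<bar>)"
    using pCons.IH [of "\<epsilon> / 2"] pCons.prems by auto
  show ?case
  proof (intro exI [of _ "\<bar>a\<bar> + 2 / \<epsilon> * C"] allI)
    fix x :: real
    let ?e = "exp (\<epsilon> / 2 * \<bar>x\<bar>)"
    have "\<epsilon> / 2 * \<bar>x\<bar> \<le> ?e"
      using exp_ge_add_one_self [of "\<epsilon> / 2 * \<bar>x\<bar>"] by linarith
    then have x: "\<bar>x\<bar> \<le> 2 / \<epsilon> * ?e"
      using pCons.prems by (simp add: field_simps)
    have ee: "?e * ?e = exp (\<epsilon> * \<bar>x\<bar>)"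
      by (simp flip: exp_add)
    have "\<bar>poly (pCons a f) x\<bar> \<le> \<bar>a\<bar> + \<bar>x\<bar> * \<bar>poly f x\<bar>"
      using abs_triangle_ineq [of a "x * poly f x"] by (simp add: abs_mult)
    also have "\<dots> \<le> \<bar>a\<bar> * exp (\<epsilon> * \<bar>x\<bar>) + (2 / \<epsilon> * ?e) * (C * ?e)"
    proof (rule add_mono)
      have "\<bar>a\<bar> * 1 \<le> \<bar>a\<bar> * exp (\<epsilon> * \<bar>x\<bar>)"
        using pCons.prems by (intro mult_left_mono) auto
      then show "\<bar>a\<bar> \<le> \<bar>a\<bar> * exp (\<epsilon> * \<bar>x\<bar>)" by simp
      show "\<bar>x\<bar> * \<bar>poly f x\<bar> \<le> (2 / \<epsilon> * ?e) * (C * ?e)"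
        using x C [of x] pCons.prems by (intro mult_mono) auto
    qed
    also have "\<dots> = (\<bar>a\<bar> + 2 / \<epsilon> * C) * exp (\<epsilon> * \<bar>x\<bar>)"
      unfolding ee [symmetric] by (simp add: algebra_simps)
    finally show "\<bar>poly (pCons a f) x\<bar> \<le> (\<bar>a\<bar> + 2 / \<epsilon> * C) * exp (\<epsilon> * \<bar>x\<bar>)" .
  qed
qed

lemma poly_integrable_exp: "poly_integrable {0..} (\<lambda>x. exp (- x))"
  unfolding poly_integrable_def
proof
  fix f :: "real poly"
  obtain C where C: "\<And>x. \<bar>poly f x\<bar> \<le> C * exp (1 / 2 * \<bar>x\<bar>)"
    using poly_exp_bound [of "1 / 2" f] by auto
  show "(\<lambda>x. poly f x * exp (- x)) integrable_on {0..}"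
  proof (rule measurable_bounded_by_integrable_imp_integrable_real)
    show "(\<lambda>x. poly f x * exp (- x)) \<in> borel_measurable (lebesgue_on {0..})"
      by (intro continuous_imp_measurable_on_sets_lebesgue continuous_intros) simp
    show "(\<lambda>x. C * exp (- (1 / 2) * x)) integrable_on {0..}"
      by (intro integrable_on_mult_right integrable_on_exp_minus_to_infinity) simp
    show "\<bar>poly f x * exp (- x)\<bar> \<le> C * exp (- (1 / 2) * x)" if "x \<in> {0..}" for x
    proof -
      have "\<bar>poly f x * exp (- x)\<bar> \<le> C * exp (1 / 2 * \<bar>x\<bar>) * exp (- x)"
        using mult_right_mono [OF C [of x], of "exp (- x)"] by (simp add: abs_mult)
      also have "\<dots> = C * exp (- (1 / 2) * x)"
        using that by (simp add: mult.assoc flip: exp_add)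
      finally show ?thesis .
    qed
  qed simp
qed

lemma poly_integrable_times_poly:
  assumes "poly_integrable S w"
  shows "poly_integrable S (\<lambda>x. poly g x * w x)"
  unfolding poly_integrable_def
proof
  fix f
  have "(\<lambda>x. poly (f * g) x * w x) integrable_on S"
    using assms unfolding poly_integrable_def by blast
  then show "(\<lambda>x. poly f x * (poly g x * w x)) integrable_on S"
    by (simp add: mult.assoc)
qed

text \<open>
  Subsets are harmless for absolutely integrable functions. Squares times a weight are of this kind,
  and every polynomial is a combination of two squares.
\<close>

lemma poly_integrable_subset:
  assumes w: "poly_integrable S w" "\<And>x. x \<in> S \<Longrightarrow> 0 \<le> w x" and T: "T \<in> sets lebesgue" "T \<subseteq> S"
  shows "poly_integrable T w"
proof -
  have abs: "(\<lambda>x. (poly f x)\<^sup>2 * w x) integrable_on T" for f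
  proof -
    have "(\<lambda>x. (poly f x)\<^sup>2 * w x) absolutely_integrable_on S"
      using w by (intro nonnegative_absolutely_integrable_1 sq_integrable) auto
    then have "(\<lambda>x. (poly f x)\<^sup>2 * w x) absolutely_integrable_on T"
      using T by (rule set_integrable_subset)
    then show ?thesis by (rule set_lebesgue_integral_eq_integral)
  qed
  show ?thesis
    unfolding poly_integrable_def
  proof
    fix f :: "real poly"
    \<comment> \<open>Polarization: \<open>4 f = (f + 1)\<^sup>2 - (f - 1)\<^sup>2\<close>.\<close>
    have "(\<lambda>x. (1 / 4) * ((poly (f + 1) x)\<^sup>2 * w x - (poly (f - 1) x)\<^sup>2 * w x)) integrable_on T"
      by (intro integrable_on_mult_right integrable_diff abs)
    then show "(\<lambda>x. poly f x * w x) integrable_on T"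
      by (rule integrable_eq) (simp add: power2_eq_square algebra_simps)
  qed
qed

lemma abs_le_1_plus_square: "\<bar>x\<bar> \<le> 1 + x\<^sup>2" for x :: real
  using zero_le_power2 [of "\<bar>x\<bar> - 1"] abs_ge_zero [of x] by (simp add: power2_eq_square algebra_simps)

text \<open>
  Away from its singularities the product grows at most like a polynomial. The form \<open>(1 + x\<^sup>2)\<^sup>N\<close>
  makes the bound itself a polynomial, to be multiplied with an exponential weight.
\<close>

lemma power_prod_growth:
  obtains N M where "0 \<le> M" "\<And>x. (\<And>j. j \<in> {1..r} \<Longrightarrow> 1 \<le> \<bar>x - c j\<bar>) \<Longrightarrow> power_prod r c \<gamma> x \<le> M * (1 + x\<^sup>2) ^ N"
proof -
  define k where "k j = nat \<lceil>\<bar>\<gamma> j\<bar>\<rceil>" for j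
  define D where "D j = 2 * (1 + \<bar>c j\<bar>)" for j
  show ?thesis
  proof (rule that)
    show "0 \<le> (\<Prod>j=1..r. D j ^ k j)"
      by (intro prod_nonneg) (auto simp: D_def)
    fix x :: real assume x: "\<And>j. j \<in> {1..r} \<Longrightarrow> 1 \<le> \<bar>x - c j\<bar>"
    have "power_prod r c \<gamma> x \<le> (\<Prod>j=1..r. (D j * (1 + x\<^sup>2)) ^ k j)"
      unfolding power_prod_def
    proof (rule prod_mono, rule conjI)
      fix j assume j: "j \<in> {1..r}"
      have x2: "1 + \<bar>x\<bar> \<le> 2 * (1 + x\<^sup>2)"
        using add_mono [OF abs_le_1_plus_square [of x] zero_le_power2 [of x]] by (simp add: distrib_left)
      have "\<bar>x - c j\<bar> \<le> (1 + \<bar>c j\<bar>) * (1 + \<bar>x\<bar>)"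
      proof -
        have "0 \<le> \<bar>c j\<bar> * \<bar>x\<bar>" by simp
        then show ?thesis
          unfolding distrib_left distrib_right using abs_triangle_ineq4 [of x "c j"] by linarith
      qed
      also have "\<dots> \<le> (1 + \<bar>c j\<bar>) * (2 * (1 + x\<^sup>2))"
        using x2 by (intro mult_left_mono) auto
      finally have le: "\<bar>x - c j\<bar> \<le> D j * (1 + x\<^sup>2)" by (simp add: D_def algebra_simps)
      have "\<gamma> j \<le> real (k j)" unfolding k_def by linarith
      then have "\<bar>x - c j\<bar> powr \<gamma> j \<le> \<bar>x - c j\<bar> powr real (k j)"
        using x [OF j] by (intro powr_mono) auto
      also have "\<dots> = \<bar>x - c j\<bar> ^ k j"
        using x [OF j] by (intro powr_realpow) auto
      also have "\<dots> \<le> (D j * (1 + x\<^sup>2)) ^ k j"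
        using le by (intro power_mono) auto
      finally show "\<bar>x - c j\<bar> powr \<gamma> j \<le> (D j * (1 + x\<^sup>2)) ^ k j" .
    qed simp
    also have "\<dots> = (\<Prod>j=1..r. D j ^ k j) * (1 + x\<^sup>2) ^ (\<Sum>j=1..r. k j)"
      by (simp add: power_mult_distrib prod.distrib power_sum)
    finally show "power_prod r c \<gamma> x \<le> (\<Prod>j=1..r. D j ^ k j) * (1 + x\<^sup>2) ^ (\<Sum>j=1..r. k j)" .
  qed
qed

lemma powr_comparable:
  fixes s t g :: real
  assumes "0 < s" "0 < t" "s \<le> 2 * t" "t \<le> 2 * s"
  shows "s powr g \<le> 2 powr \<bar>g\<bar> * t powr g"
proof -
  have "(s / t) powr g \<le> 2 powr \<bar>g\<bar>"
  proof (cases "0 \<le> g")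
    case True
    then show ?thesis using assms by (simp add: powr_mono2 divide_le_eq)
  next
    case False
    have "(s / t) powr g = (t / s) powr (- g)"
      using assms by (simp add: powr_minus powr_divide field_simps)
    also have "\<dots> \<le> 2 powr (- g)"
      using assms False by (intro powr_mono2) (auto simp: divide_le_eq)
    finally show ?thesis using False by simp
  qed
  then have "(s / t) powr g * t powr g \<le> 2 powr \<bar>g\<bar> * t powr g"
    by (intro mult_right_mono) auto
  then show ?thesis using assms by (simp add: powr_divide)
qed

text \<open>
  The factor depends on the exponents only. It is used with \<open>t\<^sub>j = \<bar>y - c\<^sub>j\<bar>\<close> at a nearby point \<open>y\<close>, and
  with \<open>t\<^sub>j = \<bar>x\<bar>\<close>, which turns the product into a single power.
\<close>

lemma prod_powr_comparable:
  fixes s t \<gamma> :: "nat \<Rightarrow> real"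
  assumes "\<And>j. j \<in> J \<Longrightarrow> 0 < s j \<and> 0 < t j \<and> s j \<le> 2 * t j \<and> t j \<le> 2 * s j"
  shows "(\<Prod>j\<in>J. s j powr \<gamma> j) \<le> (\<Prod>j\<in>J. 2 powr \<bar>\<gamma> j\<bar>) * (\<Prod>j\<in>J. t j powr \<gamma> j)"
  unfolding prod.distrib [symmetric] using assms by (intro prod_mono) (auto intro!: powr_comparable)

lemma point_sum_le:
  fixes \<gamma> :: "nat \<Rightarrow> real"
  shows "(\<Sum>j\<in>{j\<in>{1..r}. c j = x}. \<gamma> j) \<le> real (nat \<lceil>\<Sum>j=1..r. \<bar>\<gamma> j\<bar>\<rceil>)"
proof -
  have "(\<Sum>j\<in>{j\<in>{1..r}. c j = x}. \<gamma> j) \<le> (\<Sum>j\<in>{j\<in>{1..r}. c j = x}. \<bar>\<gamma> j\<bar>)"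
    by (intro sum_mono) simp
  also have "\<dots> \<le> (\<Sum>j=1..r. \<bar>\<gamma> j\<bar>)"
    by (intro sum_mono2) auto
  finally show ?thesis by linarith
qed

text \<open>
  On \<open>[0, A]\<close> the exponential factor is bounded above and below. For \<open>y \<ge> A\<close> the weight changes at most by a
  factor \<open>H exp 1\<close> on \<open>[y, y + 1]\<close>, so it is comparable there with the constant \<open>1\<close>, and the ratio of
  the two comparison constants does not depend on \<open>y\<close>. The inequalities on the pieces add up
  to one on \<open>[0, A + N]\<close>, and \<open>N\<close> tends to infinity.
\<close>

theorem generalized_laguerre:
  fixes c \<gamma> :: "nat \<Rightarrow> real"
  assumes \<gamma>: "\<And>x. 0 \<le> x \<Longrightarrow> -1 < (\<Sum>j\<in>{j\<in>{1..r}. c j = x}. \<gamma> j)"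
  defines "W \<equiv> \<lambda>x. power_prod r c \<gamma> x * exp (- x)"
  shows "poly_integrable {0..} W"
    and "\<exists>C\<ge>0. \<forall>n P. 1 \<le> n \<longrightarrow> degree P \<le> n \<longrightarrow>
      sq_int {0..} W (pderiv P) \<le> C * ((real n)\<^sup>2)\<^sup>2 * sq_int {0..} W P"
proof -
  define A where "A = 1 + (\<Sum>j=1..r. \<bar>c j\<bar>)"
  have A1: "1 \<le> A" by (simp add: A_def sum_nonneg)
  have cA: "c j + 1 \<le> A" if "j \<in> {1..r}" for j
  proof -
    have "\<bar>c j\<bar> \<le> (\<Sum>j=1..r. \<bar>c j\<bar>)" using that by (intro member_le_sum) auto
    then show ?thesis by (simp add: A_def)
  qed
  have W0: "0 \<le> W x" for x by (simp add: W_def)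
  have meas: "W \<in> borel_measurable (lebesgue_on S)" for S
    unfolding W_def by (intro borel_imp_lebesgue_on_measurable) measurable
  define k where "k = nat \<lceil>\<Sum>j=1..r. \<bar>\<gamma> j\<bar>\<rceil>"
  obtain C0 where C0: "0 \<le> C0" "markov_nikolskii k {0..A} (power_prod r c \<gamma>) C0"
    and int0: "poly_integrable {0..A} (power_prod r c \<gamma>)"
    using generalized_jacobi [where a = 0 and b = A and r = r and c = c and \<gamma> = \<gamma> and k = k] \<gamma> point_sum_le [where c = c and r = r and \<gamma> = \<gamma>] A1 by (auto simp: k_def)
  have lo: "exp (- A) * power_prod r c \<gamma> x \<le> W x" and up: "W x \<le> 1 * power_prod r c \<gamma> x" if "x \<in> {0..A}" for x
  proof -
    show "exp (- A) * power_prod r c \<gamma> x \<le> W x"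
      unfolding W_def using that by (subst mult.commute, intro mult_left_mono) auto
    show "W x \<le> 1 * power_prod r c \<gamma> x"
      unfolding W_def using that by (simp add: mult_left_le)
  qed
  have intA: "poly_integrable {0..A} W"
    by (rule comparable_weight(1) [OF _ int0 _ meas _ lo up]) auto
  have CA: "markov_nikolskii k {0..A} W (C0 * (1 + 1) / exp (- A))"
    by (rule markov_nikolskii_comparable [OF _ int0 _ meas _ lo up _ C0]) auto
  have "poly_integrable {A..} W"
  proof -
    obtain N M where M: "0 \<le> M" "\<And>x. (\<And>j. j \<in> {1..r} \<Longrightarrow> 1 \<le> \<bar>x - c j\<bar>) \<Longrightarrow> power_prod r c \<gamma> x \<le> M * (1 + x\<^sup>2) ^ N"
      by (rule power_prod_growth [of r c \<gamma>]) blast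
    have "poly_integrable {A..} (\<lambda>x. exp (- x))"
      by (rule poly_integrable_subset [OF poly_integrable_exp]) (use A1 in auto)
    then have "poly_integrable {A..} (\<lambda>x. poly ([:1, 0, 1:] ^ N) x * exp (- x))"
      by (rule poly_integrable_times_poly)
    then have int: "poly_integrable {A..} (\<lambda>x. (1 + x\<^sup>2) ^ N * exp (- x))"
      by (simp add: power2_eq_square)
    show ?thesis
    proof (rule poly_integrable_dominated [OF _ int _ meas])
      show "\<bar>W x\<bar> \<le> M * ((1 + x\<^sup>2) ^ N * exp (- x))" if "x \<in> {A..}" for x
      proof -
        have "1 \<le> \<bar>x - c j\<bar>" if "j \<in> {1..r}" for j
          using cA [OF that] \<open>x \<in> {A..}\<close> by auto
        then have "power_prod r c \<gamma> x * exp (- x) \<le> M * (1 + x\<^sup>2) ^ N * exp (- x)"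
          by (intro mult_right_mono M(2)) auto
        then show ?thesis using W0 [of x] by (simp add: W_def mult.assoc)
      qed
    qed auto
  qed
  moreover have "{0..} = {0..A} \<union> {A..}" using A1 by auto
  moreover have "negligible ({0..A} \<inter> {A..})"
    by (rule negligible_subset [of "{A}"]) auto
  ultimately show int: "poly_integrable {0..} W"
    using intA unfolding poly_integrable_def by (auto intro: integrable_Un)
  have intI: "poly_integrable {u..v} W" if "0 \<le> u" for u v
    using that by (intro poly_integrable_subset [OF int W0]) auto
  define H where "H = (\<Prod>j=1..r. 2 powr \<bar>\<gamma> j\<bar>)"
  have H: "0 < H" unfolding H_def by (intro prod_pos) auto
  have one: "(-1 :: real) < 0" "(0 :: real) < 1" by auto
  obtain C1 where C1: "0 \<le> C1" "\<And>a b n P. b - a = 1 \<Longrightarrow> 1 \<le> n \<Longrightarrow> degree P \<le> n \<Longrightarrow>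
       integral {a..b} (\<lambda>x. (poly (pderiv P) x)\<^sup>2 * jac a b 0 0 x)
         \<le> C1 * ((real n)\<^sup>2)\<^sup>2 * integral {a..b} (\<lambda>x. (poly P x)\<^sup>2 * jac a b 0 0 x)"
    by (rule jac_markov [OF one(1) one(1) one(2)]) blast
  have jac1: "integral {a..b} (\<lambda>x. (poly Q x)\<^sup>2 * jac a b 0 0 x) = sq_int {a..b} (\<lambda>_. 1) Q" for a b :: real and Q
    unfolding sq_int_def by (rule integral_spike [of "{a, b}"]) (auto simp: jac_def)
  define C where "C = max (C0 * (1 + 1) / exp (- A)) (H * (C1 * (H * exp 1)))"
  have unit: "sq_int {y..y + 1} W (pderiv P) \<le> C * ((real n)\<^sup>2)\<^sup>2 * sq_int {y..y + 1} W P"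
    if y: "A \<le> y" and n: "1 \<le> n" "degree P \<le> n" for y n P
  proof -
    have cy: "\<And>j. j \<in> {1..r} \<Longrightarrow> c j + 1 \<le> y" using cA y by fastforce
    have Wy: "0 < W y"
    proof -
      have "\<bar>y - c j\<bar> powr \<gamma> j > 0" if "j \<in> {1..r}" for j using cy [OF that] by auto
      then have "0 < power_prod r c \<gamma> y"
        unfolding power_prod_def by (rule prod_pos)
      then show ?thesis by (simp add: W_def)
    qed
    let ?m = "W y / (H * exp 1)"
    have m: "0 < ?m" using Wy H by simp
    have up: "W x \<le> (H * W y) * 1" and lo: "?m * 1 \<le> W x" if x: "x \<in> {y..y + 1}" for x
    proof -
      have pp: "power_prod r c \<gamma> x \<le> H * power_prod r c \<gamma> y" "power_prod r c \<gamma> y \<le> H * power_prod r c \<gamma> x"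
        unfolding power_prod_def H_def using x cy by (force intro!: prod_powr_comparable)+
      have "W x \<le> (H * power_prod r c \<gamma> y) * exp (- y)"
        unfolding W_def using pp(1) x H by (intro mult_mono) auto
      then show "W x \<le> (H * W y) * 1" by (simp add: W_def mult.assoc)
      have "W y \<le> (H * power_prod r c \<gamma> x) * (exp 1 * exp (- x))"
        unfolding W_def using pp(2) x H by (intro mult_mono) (auto simp flip: exp_add)
      then have "W y \<le> W x * (H * exp 1)" by (simp add: W_def mult_ac)
      then show "?m * 1 \<le> W x" using H by (simp add: pos_divide_le_eq)
    qed
    note cmp = comparable_weight [OF _ poly_integrable_1 _ meas m lo up]
    have "sq_int {y..y + 1} W (pderiv P) \<le> (H * W y) * sq_int {y..y + 1} (\<lambda>_. 1) (pderiv P)"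
      by (rule cmp(3)) auto
    also have "\<dots> \<le> (H * W y) * (C1 * ((real n)\<^sup>2)\<^sup>2 * sq_int {y..y + 1} (\<lambda>_. 1) P)"
      using C1(2) [of "y + 1" y n P] n Wy H unfolding jac1 by (intro mult_left_mono) auto
    also have "\<dots> = (H * (C1 * (H * exp 1))) * ((real n)\<^sup>2)\<^sup>2 * (?m * sq_int {y..y + 1} (\<lambda>_. 1) P)"
      using H by simp
    also have "\<dots> \<le> (H * (C1 * (H * exp 1))) * ((real n)\<^sup>2)\<^sup>2 * sq_int {y..y + 1} W P"
      by (intro mult_left_mono cmp(2)) (use H C1 in auto)
    also have "\<dots> \<le> C * ((real n)\<^sup>2)\<^sup>2 * sq_int {y..y + 1} W P"
      using A1 y by (intro mult_right_mono sq_int_nonneg intI W0) (auto simp: C_def)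
    finally show ?thesis .
  qed
  have fin: "sq_int {0..A + real N} W (pderiv P) \<le> C * ((real n)\<^sup>2)\<^sup>2 * sq_int {0..A + real N} W P"
    if n: "1 \<le> n" "degree P \<le> n" for N n P
  proof (induction N)
    case 0
    have "markov_nikolskii k {0..A} W C"
      by (rule markov_nikolskii_mono [OF CA _ intA W0]) (simp add: C_def)
    then show ?case using n by (simp add: markov_nikolskii_def)
  next
    case (Suc N)
    have eq: "sq_int {0..A + real (Suc N)} W Q = sq_int {0..A + real N} W Q + sq_int {A + real N..A + real N + 1} W Q" for Q
      using sq_int_combine [of 0 "A + real N" "A + real (Suc N)" W Q] intI [of 0] A1 by (simp add: add_ac)
    show ?case
      unfolding eq distrib_left using Suc.IH unit [of "A + real N" n P] n by (intro add_mono) auto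
  qed
  show "\<exists>C\<ge>0. \<forall>n P. 1 \<le> n \<longrightarrow> degree P \<le> n \<longrightarrow>
      sq_int {0..} W (pderiv P) \<le> C * ((real n)\<^sup>2)\<^sup>2 * sq_int {0..} W P"
  proof (intro exI [of _ C] conjI allI impI)
    show C: "0 \<le> C" using C1 H by (simp add: C_def le_max_iff_disj)
    fix n and P :: "real poly"
    assume n: "1 \<le> n" "degree P \<le> n"
    have conv: "(\<lambda>N. sq_int {0..A + real N} W (pderiv P)) \<longlonglongrightarrow> sq_int {0..} W (pderiv P)"
    proof -
      let ?f = "\<lambda>x. (poly (pderiv P) x)\<^sup>2 * W x"
      have abs: "?f absolutely_integrable_on {0..}"
        using W0 by (intro nonnegative_absolutely_integrable_1 sq_integrable int) auto
      have abs': "?f absolutely_integrable_on {0..b}" for b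
        by (rule set_integrable_subset [OF abs]) auto
      have "((\<lambda>b. LINT x:{0..b}|lebesgue. ?f x) \<longlongrightarrow> (LINT x:{0..}|lebesgue. ?f x)) at_top"
        by (rule tendsto_set_lebesgue_integral_at_top [OF _ abs]) simp
      then have "((\<lambda>b. sq_int {0..b} W (pderiv P)) \<longlongrightarrow> sq_int {0..} W (pderiv P)) at_top"
        by (simp add: sq_int_def set_lebesgue_integral_eq_integral(2) abs abs')
      moreover have "filterlim (\<lambda>N. A + real N) at_top sequentially"
        by (intro filterlim_tendsto_add_at_top [OF tendsto_const] filterlim_real_sequentially)
      ultimately show ?thesis by (rule filterlim_compose)
    qed
    have mono: "sq_int {0..A + real N} W P \<le> sq_int {0..} W P" for N
      unfolding sq_int_def using W0
      by (intro integral_subset_le sq_integrable intI int) auto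
    show "sq_int {0..} W (pderiv P) \<le> C * ((real n)\<^sup>2)\<^sup>2 * sq_int {0..} W P"
    proof (rule LIMSEQ_le_const2 [OF conv], intro exI allI impI)
      show "sq_int {0..A + real N} W (pderiv P) \<le> C * ((real n)\<^sup>2)\<^sup>2 * sq_int {0..} W P" for N
        using fin [OF n, of N] mult_left_mono [OF mono, of "C * ((real n)\<^sup>2)\<^sup>2" N] C by force
    qed
  qed
qed

section \<open>Generalized Hermite weights\<close>

lemma hermite_weight_nonneg [simp]: "0 \<le> hermite_weight \<alpha> x"
  by (simp add: hermite_weight_def)

lemma hermite_weight_even: "hermite_weight \<alpha> (- x) = hermite_weight \<alpha> x"
  by (simp add: hermite_weight_def)

lemma hermite_weight_measurable: "hermite_weight \<alpha> \<in> borel_measurable borel"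
  unfolding hermite_weight_def by measurable

text \<open>
  This bound provides both the integrability against the weight and the vanishing of the boundary
  terms at infinity in the Pearson identity.
\<close>

lemma poly_hermite_bound:
  assumes "0 \<le> \<alpha>"
  obtains C where "\<And>x. \<bar>poly f x * hermite_weight \<alpha> x\<bar> \<le> C * exp (- \<bar>x\<bar>)"
proof -
  define N where "N = nat \<lceil>\<alpha>\<rceil>"
  obtain C where C: "\<And>x. \<bar>poly (f * [:1, 0, 1:] ^ N) x\<bar> \<le> C * exp (1 * \<bar>x\<bar>)"
    using poly_exp_bound [of 1 "f * [:1, 0, 1:] ^ N"] by auto
  have C0: "0 \<le> C"
  proof -
    have "0 \<le> C * exp (1 * \<bar>0\<bar>)" using C [of 0] abs_ge_zero order_trans by blast
    then show ?thesis by simp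
  qed
  show ?thesis
  proof (rule that)
    fix x :: real
    have "\<bar>x\<bar> powr \<alpha> \<le> (1 + x\<^sup>2) powr \<alpha>"
      using assms abs_le_1_plus_square by (intro powr_mono2) auto
    also have "\<dots> \<le> (1 + x\<^sup>2) powr real N"
      unfolding N_def by (intro powr_mono) (linarith, simp)
    also have "\<dots> = (1 + x\<^sup>2) ^ N"
      by (intro powr_realpow) (simp add: add_pos_nonneg)
    finally have "\<bar>poly f x\<bar> * \<bar>x\<bar> powr \<alpha> \<le> \<bar>poly f x\<bar> * (1 + x\<^sup>2) ^ N"
      by (intro mult_left_mono) auto
    also have "\<dots> = \<bar>poly (f * [:1, 0, 1:] ^ N) x\<bar>"
    proof -
      have "0 \<le> (1 + x\<^sup>2) ^ N" by simp
      then show ?thesis by (simp add: abs_mult power2_eq_square)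
    qed
    also have "\<dots> \<le> C * exp \<bar>x\<bar>" using C [of x] by simp
    finally have "\<bar>poly f x\<bar> * \<bar>x\<bar> powr \<alpha> * exp (- x\<^sup>2) \<le> C * exp \<bar>x\<bar> * exp (- x\<^sup>2)"
      by (rule mult_right_mono) simp
    also have "\<dots> = C * exp (\<bar>x\<bar> - x\<^sup>2)" by (simp add: exp_diff exp_minus divide_inverse)
    also have "\<dots> \<le> C * exp (1 - \<bar>x\<bar>)"
    proof -
      have "0 \<le> (\<bar>x\<bar> - 1)\<^sup>2" by simp
      then have "\<bar>x\<bar> - x\<^sup>2 \<le> 1 - \<bar>x\<bar>" by (simp add: power2_eq_square algebra_simps)
      then show ?thesis using C0 by (intro mult_left_mono) auto
    qed
    finally show "\<bar>poly f x * hermite_weight \<alpha> x\<bar> \<le> (C * exp 1) * exp (- \<bar>x\<bar>)"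
      by (simp add: hermite_weight_def abs_mult exp_diff exp_minus divide_inverse mult.assoc)
  qed
qed

lemma integrable_exp_abs: "(\<lambda>x :: real. exp (- \<bar>x\<bar>)) integrable_on UNIV"
proof -
  have 1: "(\<lambda>x :: real. exp (- x)) absolutely_integrable_on {0..}"
    using integrable_on_exp_minus_to_infinity [of 1 0] by (intro nonnegative_absolutely_integrable_1) auto
  then have "(\<lambda>x :: real. exp (- (- x))) absolutely_integrable_on {..0}"
    using has_absolute_integral_reflect_real [of "{..0}" "{0..}" "\<lambda>x. exp (- x)"] by auto
  then have "(\<lambda>x :: real. exp (- \<bar>x\<bar>)) integrable_on {..0}"
    by (intro integrable_eq [OF set_lebesgue_integral_eq_integral(1)]) auto
  moreover have "(\<lambda>x :: real. exp (- \<bar>x\<bar>)) integrable_on {0..}"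
    using 1 by (intro integrable_eq [OF set_lebesgue_integral_eq_integral(1)]) auto
  moreover have "negligible ({..0 :: real} \<inter> {0..})"
    by (rule negligible_subset [of "{0}"]) auto
  moreover have "(UNIV :: real set) = {..0} \<union> {0..}" by auto
  ultimately show ?thesis using integrable_Un by metis
qed

lemma poly_integrable_hermite:
  assumes "0 \<le> \<alpha>"
  shows "poly_integrable UNIV (hermite_weight \<alpha>)"
  unfolding poly_integrable_def
proof
  fix f :: "real poly"
  obtain C where C: "\<And>x. \<bar>poly f x * hermite_weight \<alpha> x\<bar> \<le> C * exp (- \<bar>x\<bar>)"
    using poly_hermite_bound [OF assms] by blast
  show "(\<lambda>x. poly f x * hermite_weight \<alpha> x) integrable_on UNIV"
  proof (rule measurable_bounded_by_integrable_imp_integrable_real)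
    have "(\<lambda>x. poly f x * hermite_weight \<alpha> x) \<in> borel_measurable borel"
      by (intro borel_measurable_times hermite_weight_measurable)
        (intro borel_measurable_continuous_onI continuous_intros)
    then show "(\<lambda>x. poly f x * hermite_weight \<alpha> x) \<in> borel_measurable (lebesgue_on UNIV)"
      by (rule borel_imp_lebesgue_on_measurable)
    show "(\<lambda>x. C * exp (- \<bar>x\<bar>)) integrable_on UNIV"
      using integrable_exp_abs by (rule integrable_on_mult_right)
  qed (use C in auto)
qed

definition hermite_functional :: "real \<Rightarrow> real poly \<Rightarrow> real" where
  "hermite_functional \<alpha> f = integral UNIV (\<lambda>x. poly f x * hermite_weight \<alpha> x)"

lemma hermite_functional_add:
  "0 \<le> \<alpha> \<Longrightarrow> hermite_functional \<alpha> (f + g) = hermite_functional \<alpha> f + hermite_functional \<alpha> g"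
  using poly_integrable_hermite [of \<alpha>] unfolding hermite_functional_def poly_integrable_def
  by (simp add: distrib_right Henstock_Kurzweil_Integration.integral_add)

lemma hermite_functional_smult: "hermite_functional \<alpha> (smult c f) = c * hermite_functional \<alpha> f"
  unfolding hermite_functional_def by (simp add: mult.assoc)

lemma hermite_functional_square: "hermite_functional \<alpha> (f * f) = sq_int UNIV (hermite_weight \<alpha>) f"
  by (simp add: hermite_functional_def sq_int_def power2_eq_square)

lemma hermite_functional_odd:
  assumes "0 \<le> \<alpha>" "\<And>x. poly f (- x) = - poly f x"
  shows "hermite_functional \<alpha> f = 0"
proof -
  let ?g = "\<lambda>x. poly f x * hermite_weight \<alpha> x"
  have abs: "?g absolutely_integrable_on UNIV"
  proof (rule absolutely_integrable_integrable_bound)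
    have *: "(\<lambda>x. poly (1 + f * f) x * hermite_weight \<alpha> x) integrable_on UNIV" "?g integrable_on UNIV"
      using poly_integrable_hermite [OF assms(1)] unfolding poly_integrable_def by blast+
    then show "(\<lambda>x. poly (1 + f * f) x * hermite_weight \<alpha> x) integrable_on UNIV" "?g integrable_on UNIV"
      by auto
    show "norm (?g x) \<le> poly (1 + f * f) x * hermite_weight \<alpha> x" for x
      using mult_right_mono [OF abs_le_1_plus_square [of "poly f x"], of "hermite_weight \<alpha> x"]
      by (simp add: abs_mult power2_eq_square)
  qed
  have "integral UNIV (\<lambda>x. ?g (- x)) = integral UNIV ?g"
    using has_absolute_integral_reflect_real [of UNIV UNIV ?g "integral UNIV ?g"] abs by simp
  then show ?thesis
    using assms(2) by (simp add: hermite_weight_even hermite_functional_def)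
qed

lemma abs_powr_eq: "\<bar>x\<bar> powr \<alpha> = (x\<^sup>2) powr (\<alpha> / 2)" for x :: real
proof (cases "x = 0")
  case False
  have "ln (\<bar>x\<bar>\<^sup>2) = 2 * ln \<bar>x\<bar>"
    using False by (subst ln_realpow) auto
  then show ?thesis
    using False by (simp add: powr_def)
qed simp

text \<open>
  The integral of the derivative of \<open>x f w\<close>. For \<open>\<alpha> > 0\<close> the plain Pearson identity, without the
  factor \<open>x\<close>, would involve the rational function \<open>\<alpha> / x\<close>.
\<close>

lemma hermite_pearson:
  assumes \<alpha>: "0 \<le> \<alpha>"
  shows "hermite_functional \<alpha> ([:0, 1:] * pderiv f + [:\<alpha> + 1, 0, - 2:] * f) = 0"
proof -
  let ?h = "[:0, 1:] * pderiv f + [:\<alpha> + 1, 0, - 2:] * f"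
  let ?F = "\<lambda>x. poly ([:0, 1:] * f) x * hermite_weight \<alpha> x"
  let ?g = "\<lambda>x. poly ?h x * hermite_weight \<alpha> x"
  have F: "?F x = poly f x * exp (- x\<^sup>2) * (x * \<bar>x\<bar> powr \<alpha>)" for x
    by (simp add: hermite_weight_def)
  have cont: "continuous_on S ?F" for S
  proof -
    \<comment> \<open>The factor \<open>x\<close> removes the discontinuity that \<open>0 powr 0 = 0\<close> causes for \<open>\<alpha> = 0\<close>.\<close>
    have "x * \<bar>x\<bar> powr \<alpha> = max x 0 powr (\<alpha> + 1) - max (- x) 0 powr (\<alpha> + 1)" for x :: real
      using \<alpha> powr_mult_base [of "\<bar>x\<bar>" \<alpha>] by (cases "0 \<le> x") (auto simp: max_def add.commute)
    then show ?thesis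
      unfolding F using \<alpha> by (simp, intro continuous_intros continuous_on_powr') auto
  qed
  have der: "(?F has_vector_derivative ?g x) (at x)" if "x \<noteq> 0" for x
  proof -
    have x2: "0 < x\<^sup>2" using that by simp
    have eq: "?F = (\<lambda>x. poly f x * exp (- x\<^sup>2) * (x * (x\<^sup>2) powr (\<alpha> / 2)))"
      unfolding F abs_powr_eq ..
    have p: "(x\<^sup>2) powr (\<alpha> / 2 - 1) = (x\<^sup>2) powr (\<alpha> / 2) / x\<^sup>2"
      using x2 by (simp add: powr_diff)
    have "(?F has_real_derivative
        poly (pderiv f) x * (exp (- x\<^sup>2) * (x * (x\<^sup>2) powr (\<alpha> / 2)))
        + poly f x * (exp (- x\<^sup>2) * (- 2 * x) * (x * (x\<^sup>2) powr (\<alpha> / 2)))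
        + poly f x * (exp (- x\<^sup>2) * ((x\<^sup>2) powr (\<alpha> / 2) + x * (\<alpha> / 2 * (x\<^sup>2) powr (\<alpha> / 2 - 1) * (2 * x))))) (at x)"
      unfolding eq using x2 by (auto intro!: derivative_eq_intros simp: algebra_simps)
    also have "x * (\<alpha> / 2 * (x\<^sup>2) powr (\<alpha> / 2 - 1) * (2 * x)) = \<alpha> * (x\<^sup>2) powr (\<alpha> / 2)"
      unfolding p using that by (simp add: power2_eq_square)
    also have "poly (pderiv f) x * (exp (- x\<^sup>2) * (x * (x\<^sup>2) powr (\<alpha> / 2)))
        + poly f x * (exp (- x\<^sup>2) * (- 2 * x) * (x * (x\<^sup>2) powr (\<alpha> / 2)))
        + poly f x * (exp (- x\<^sup>2) * ((x\<^sup>2) powr (\<alpha> / 2) + \<alpha> * (x\<^sup>2) powr (\<alpha> / 2)))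
        = ?g x"
      by (simp add: hermite_weight_def abs_powr_eq power2_eq_square algebra_simps)
    finally show ?thesis by (simp add: has_real_derivative_iff_has_vector_derivative)
  qed
  have ftc: "(?g has_integral (?F (real N) - ?F (- real N))) {- real N..real N}" for N
    by (rule fundamental_theorem_of_calculus_interior_strong [of "{0}"]) (use der cont in auto)
  obtain C where C: "\<And>x. \<bar>?F x\<bar> \<le> C * exp (- \<bar>x\<bar>)"
    using poly_hermite_bound [OF \<alpha>] by blast
  have e: "(\<lambda>N. C * exp (- real N)) \<longlonglongrightarrow> C * 0"
    by (intro tendsto_mult tendsto_const filterlim_compose [OF exp_at_bot] filterlim_uminus_at_bot_at_top [THEN filterlim_compose] filterlim_real_sequentially)
  have lim0: "(\<lambda>N. ?F (real N) - ?F (- real N)) \<longlonglongrightarrow> 0 - 0"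
  proof (intro tendsto_diff)
    show "(\<lambda>N. ?F (real N)) \<longlonglongrightarrow> 0" "(\<lambda>N. ?F (- real N)) \<longlonglongrightarrow> 0"
      using C [of "real _"] C [of "- real _"] e
      by (auto intro!: Lim_null_comparison [where g = "\<lambda>N. C * exp (- real N)"] always_eventually)
  qed
  have abs: "?g absolutely_integrable_on UNIV"
  proof (rule absolutely_integrable_integrable_bound)
    have *: "(\<lambda>x. poly (1 + ?h * ?h) x * hermite_weight \<alpha> x) integrable_on UNIV" "?g integrable_on UNIV"
      using poly_integrable_hermite [OF \<alpha>] unfolding poly_integrable_def by blast+
    then show "(\<lambda>x. poly (1 + ?h * ?h) x * hermite_weight \<alpha> x) integrable_on UNIV" "?g integrable_on UNIV"
      by auto
    show "norm (?g x) \<le> poly (1 + ?h * ?h) x * hermite_weight \<alpha> x" for x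
    proof -
      have "norm (?g x) = \<bar>poly ?h x\<bar> * hermite_weight \<alpha> x"
        by (simp only: real_norm_def abs_mult abs_of_nonneg hermite_weight_nonneg)
      also have "\<dots> \<le> (1 + (poly ?h x)\<^sup>2) * hermite_weight \<alpha> x"
        by (intro mult_right_mono abs_le_1_plus_square) simp
      finally show ?thesis by (simp only: poly_add poly_1 poly_mult [of ?h] power2_eq_square)
    qed
  qed
  have "(\<lambda>N. LINT x:{- real N..real N}|lebesgue. ?g x) \<longlonglongrightarrow> (LINT x:(\<Union>N. {- real N..real N})|lebesgue. ?g x)"
  proof (rule set_integral_cont_up)
    show "incseq (\<lambda>N. {- real N..real N})" by (auto simp: incseq_def)
    show "set_integrable lebesgue (\<Union>N. {- real N..real N}) ?g"
      by (rule set_integrable_subset [OF abs]) auto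
  qed simp
  moreover have "(\<Union>N. {- real N..real N}) = UNIV"
  proof -
    have "\<exists>N. x \<in> {- real N..real N}" for x
    proof -
      obtain N where "\<bar>x\<bar> \<le> real N" using real_arch_simple by blast
      then show ?thesis by (intro exI [of _ N]) auto
    qed
    then show ?thesis by blast
  qed
  moreover have "(LINT x:{- real N..real N}|lebesgue. ?g x) = ?F (real N) - ?F (- real N)" for N
  proof -
    have "?g absolutely_integrable_on {- real N..real N}"
      by (rule set_integrable_subset [OF abs]) auto
    then show ?thesis
      using ftc [of N] by (simp add: set_lebesgue_integral_eq_integral(2) integral_unique)
  qed
  moreover have "(LINT x:UNIV|lebesgue. ?g x) = hermite_functional \<alpha> ?h"
    unfolding hermite_functional_def by (rule set_lebesgue_integral_eq_integral(2) [OF abs])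
  ultimately have "(\<lambda>N. ?F (real N) - ?F (- real N)) \<longlonglongrightarrow> hermite_functional \<alpha> ?h"
    by (simp only:)
  then show ?thesis using lim0 LIMSEQ_unique by fastforce
qed

lemma poly_ext: "(\<And>x. poly p x = poly q x) \<Longrightarrow> p = q" for p q :: "real poly"
  by (metis poly_eq_poly_eq_iff ext)

lemma even_odd_decomposition:
  fixes P :: "real poly"
  obtains E F where "P = pcompose E [:0, 0, 1:] + [:0, 1:] * pcompose F [:0, 0, 1:]"
    "\<And>i. coeff E i = coeff P (2 * i)" "\<And>i. coeff F i = coeff P (2 * i + 1)"
proof -
  have "\<exists>E F. P = pcompose E [:0, 0, 1:] + [:0, 1:] * pcompose F [:0, 0, 1:] \<and>
    (\<forall>i. coeff E i = coeff P (2 * i)) \<and> (\<forall>i. coeff F i = coeff P (2 * i + 1))"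
  proof (induction P)
    case 0
    then show ?case by (intro exI [of _ 0]) simp
  next
    case (pCons a P)
    then obtain E F where *: "P = pcompose E [:0, 0, 1:] + [:0, 1:] * pcompose F [:0, 0, 1:]"
      "\<And>i. coeff E i = coeff P (2 * i)" "\<And>i. coeff F i = coeff P (2 * i + 1)" by blast
    show ?case
    proof (rule exI [of _ "pCons a F"], rule exI [of _ E], intro conjI allI)
      show "pCons a P = pcompose (pCons a F) [:0, 0, 1:] + [:0, 1:] * pcompose E [:0, 0, 1:]"
        by (subst *(1)) (simp add: pcompose_pCons)
      show "coeff (pCons a F) i = coeff (pCons a P) (2 * i)" for i
        using * by (cases i) auto
      show "coeff E i = coeff (pCons a P) (2 * i + 1)" for i
        using * by simp
    qed
  qed
  then show ?thesis using that by blast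
qed

text \<open>
  Write \<open>P = E(x\<^sup>2) + x F(x\<^sup>2)\<close>. The functionals \<open>Ev g = L (g(x\<^sup>2))\<close> and \<open>Od g = L (x\<^sup>2 g(x\<^sup>2))\<close> are Laguerre
  functionals (\<open>p = t\<close>) with exponents \<open>(\<alpha> - 1) / 2\<close> and \<open>(\<alpha> + 1) / 2\<close> and eigenvalues \<open>\<mu>\<^sub>m = m\<close>; that
  they satisfy a Pearson identity follows from the one of \<open>L\<close> without any change of variables. Odd
  polynomials have integral \<open>0\<close>, so the even and the odd part can be estimated separately: the former
  gives \<open>4 (n div 2) \<le> 2 n\<close>, the latter \<open>2 + 4 ((n - 1) div 2) \<le> 2 n\<close>. The assumption \<open>\<alpha> \<ge> 0\<close>
  gives the term \<open>- \<alpha> Ev (F\<^sup>2)\<close> the right sign.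
\<close>

theorem hermite_markov:
  assumes \<alpha>: "0 \<le> \<alpha>" and n: "degree P \<le> n"
  shows "sq_int UNIV (hermite_weight \<alpha>) (pderiv P) \<le> 2 * real n * sq_int UNIV (hermite_weight \<alpha>) P"
proof -
  let ?L = "hermite_functional \<alpha>"
  let ?q = "[:0, 0, 1:] :: real poly" and ?x = "[:0, 1:] :: real poly"
  note L = hermite_functional_add [OF \<alpha>] hermite_functional_smult
  have dq: "pderiv ?q = smult 2 ?x" by (simp add: pderiv_pCons)
  define Ev where "Ev g = ?L (pcompose g ?q)" for g
  define Od where "Od g = Ev (?x * g)" for g
  have Ev: "Ev (f + g) = Ev f + Ev g" "Ev (smult c f) = c * Ev f" for f g c
    by (simp_all add: Ev_def pcompose_add pcompose_smult L)
  have Ev_pearson: "Ev ([:0, 1, 0:] * pderiv g + [:(\<alpha> + 1) / 2, - 1:] * g) = 0" for g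
  proof -
    have "pcompose ([:0, 1, 0:] * pderiv g + [:(\<alpha> + 1) / 2, - 1:] * g) ?q
      = smult (1 / 2) (?x * pderiv (pcompose g ?q) + [:\<alpha> + 1, 0, - 2:] * pcompose g ?q)"
      unfolding pderiv_pcompose dq
      by (rule poly_ext) (simp add: poly_pcompose algebra_simps add_divide_distrib)
    then show ?thesis
      by (simp only: Ev_def hermite_functional_smult hermite_pearson [OF \<alpha>] mult_zero_right)
  qed
  interpret Ev: pearson_functional Ev 0 1 0 "(\<alpha> + 1) / 2" "-1"
  proof
    show "0 \<le> Ev (f * f)" for f
      unfolding Ev_def pcompose_mult hermite_functional_square
      by (rule sq_int_nonneg [OF poly_integrable_hermite [OF \<alpha>]]) simp
    show "Ev ([:0, 1, 0:] * pderiv f + [:(\<alpha> + 1) / 2, - 1:] * f) = 0" for f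
      by (rule Ev_pearson)
  qed (simp_all only: Ev)
  interpret Ev: strict_pearson_functional Ev 0 1 0 "(\<alpha> + 1) / 2" "-1"
    by unfold_locales (simp add: Ev.eigval_def)
  interpret Od: pearson_functional Od 0 1 0 "(\<alpha> + 3) / 2" "-1"
  proof
    show "Od (f + g) = Od f + Od g" "Od (smult c f) = c * Od f" for f g c
      unfolding Od_def by (simp_all only: distrib_left mult_smult_right Ev)
    show "0 \<le> Od (f * f)" for f
    proof -
      have "pcompose (?x * (f * f)) ?q = (?x * pcompose f ?q) * (?x * pcompose f ?q)"
          by (rule poly_ext) (simp add: poly_pcompose algebra_simps)
      then show ?thesis
        unfolding Od_def Ev_def
        by (simp only: hermite_functional_square) (rule sq_int_nonneg [OF poly_integrable_hermite [OF \<alpha>]], simp)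
    qed
    show "Od ([:0, 1, 0:] * pderiv g + [:(\<alpha> + 3) / 2, - 1:] * g) = 0" for g
    proof -
      have "?x * ([:0, 1, 0:] * pderiv g + [:(\<alpha> + 3) / 2, - 1:] * g)
          = [:0, 1, 0:] * pderiv (?x * g) + [:(\<alpha> + 1) / 2, - 1:] * (?x * g)"
        by (rule poly_ext) (simp add: pderiv_mult pderiv_pCons algebra_simps add_divide_distrib)
      then show ?thesis unfolding Od_def by (simp only: Ev_pearson)
    qed
  qed
  interpret Od: strict_pearson_functional Od 0 1 0 "(\<alpha> + 3) / 2" "-1"
    by unfold_locales (simp add: Od.eigval_def)
  have eig: "Ev.eigval m = real m" "Od.eigval m = real m" for m
    by (simp_all add: Ev.eigval_def Od.eigval_def)
  have key: "?L ((?x * pcompose A ?q + pcompose B ?q) * (?x * pcompose A ?q + pcompose B ?q))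
      = Ev (?x * (A * A)) + Ev (B * B)" for A B
  proof -
    have "(?x * pcompose A ?q + pcompose B ?q) * (?x * pcompose A ?q + pcompose B ?q)
        = pcompose (?x * (A * A)) ?q + pcompose (B * B) ?q + smult 2 (?x * pcompose (A * B) ?q)"
      by (rule poly_ext) (simp add: poly_pcompose algebra_simps)
    moreover have "?L (?x * pcompose (A * B) ?q) = 0"
      by (rule hermite_functional_odd [OF \<alpha>]) (simp add: poly_pcompose)
    ultimately show ?thesis by (simp only: L Ev_def)
  qed
  obtain E F where P: "P = pcompose E ?q + ?x * pcompose F ?q"
    and coeffs: "\<And>i. coeff E i = coeff P (2 * i)" "\<And>i. coeff F i = coeff P (2 * i + 1)"
    by (rule even_odd_decomposition [of P]) blast
  have degE: "degree E \<le> n div 2"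
    using n by (intro degree_le allI impI) (simp add: coeffs coeff_eq_0)
  have degF: "degree F \<le> (n - 1) div 2"
    using n by (intro degree_le allI impI) (simp add: coeffs coeff_eq_0)
  have F0: "F = 0" if "n = 0"
    using n that by (intro poly_eqI) (simp add: coeffs coeff_eq_0)
  define O2 where "O2 = F + smult 2 (?x * pderiv F)"
  have P': "pderiv P = ?x * pcompose (smult 2 (pderiv E)) ?q + pcompose O2 ?q"
    unfolding P pderiv_add pderiv_mult pderiv_pcompose dq O2_def
    by (rule poly_ext) (simp add: poly_pcompose pderiv_pCons algebra_simps)
  have sqP: "?L (P * P) = Ev (E * E) + Od (F * F)"
    using key [of F E] by (simp add: P Od_def add.commute)
  have sqP': "?L (pderiv P * pderiv P) = 4 * Ev ([:0, 1, 0:] * pderiv E * pderiv E) + Ev (O2 * O2)"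
  proof -
    have "?x * (smult 2 (pderiv E) * smult 2 (pderiv E)) = smult 4 ([:0, 1, 0:] * pderiv E * pderiv E)"
      by simp
    then show ?thesis unfolding P' key by (simp only: Ev)
  qed
  \<comment> \<open>The Pearson identity for \<open>F\<^sup>2\<close> turns the mixed term into terms without derivatives.\<close>
  have "Ev (O2 * O2) = 2 * Od (F * F) + 4 * Od ([:0, 1, 0:] * pderiv F * pderiv F) - \<alpha> * Ev (F * F)"
  proof -
    have "O2 * O2 = smult 2 ([:0, 1, 0:] * pderiv (F * F) + [:(\<alpha> + 1) / 2, - 1:] * (F * F))
        + (smult (- \<alpha>) (F * F) + (smult 2 (?x * (F * F)) + smult 4 (?x * ([:0, 1, 0:] * pderiv F * pderiv F))))"
      unfolding O2_def by (rule poly_ext) (simp add: pderiv_mult algebra_simps add_divide_distrib)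
    then show ?thesis
      unfolding Od_def using Ev_pearson [of "F * F"] by (simp only: Ev)
  qed
  also have "\<dots> \<le> 2 * Od (F * F) + 4 * (real ((n - 1) div 2) * Od (F * F)) - 0"
    using Od.bernstein [OF degF] Ev.square_nonneg [of F] \<alpha> by (intro diff_mono add_left_mono) (auto simp: eig)
  also have "\<dots> \<le> 2 * real n * Od (F * F)"
  proof (cases "n = 0")
    case True
    then show ?thesis using F0 Od.scale [of 0 0] by simp
  next
    case False
    then have "2 + 4 * ((n - 1) div 2) \<le> 2 * n" by linarith
    then have "real (2 + 4 * ((n - 1) div 2)) \<le> real (2 * n)"
      by (rule of_nat_mono)
    then have "2 + 4 * real ((n - 1) div 2) \<le> 2 * real n"
      by (simp only: of_nat_add of_nat_mult of_nat_numeral)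
    from mult_right_mono [OF this Od.square_nonneg [of F]] show ?thesis
      by (simp add: algebra_simps)
  qed
  finally have O2: "Ev (O2 * O2) \<le> 2 * real n * Od (F * F)" .
  have "4 * Ev ([:0, 1, 0:] * pderiv E * pderiv E) \<le> 4 * (real (n div 2) * Ev (E * E))"
    using Ev.bernstein [OF degE] by (simp add: eig)
  also have "\<dots> \<le> 2 * real n * Ev (E * E)"
  proof -
    have "4 * (n div 2) \<le> 2 * n" by linarith
    then have "real (4 * (n div 2)) \<le> real (2 * n)"
      by (rule of_nat_mono)
    then have "4 * real (n div 2) \<le> 2 * real n"
      by (simp only: of_nat_mult of_nat_numeral)
    from mult_right_mono [OF this Ev.square_nonneg [of E]] show ?thesis
      by (simp add: algebra_simps)
  qed
  finally have "?L (pderiv P * pderiv P) \<le> 2 * real n * ?L (P * P)"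
    using O2 unfolding sqP sqP' distrib_left by linarith
  then show ?thesis by (simp only: hermite_functional_square)
qed

text \<open>
  On the outer set \<open>T\<close> the weight \<open>W\<close> is comparable with \<open>w = \<bar>x\<bar>\<^sup>S exp (- x\<^sup>2)\<close>, where \<open>S\<close> is the sum of the
  exponents. The inequality for \<open>w\<close> holds on the whole line only, so it brings in
  the norm of \<open>P\<close> for \<open>w\<close> on the inner interval \<open>I\<close>. There \<open>w\<close> is bounded, and the unweighted
  norm is controlled by the one for \<open>W\<close> with a factor \<open>O(n\<^sup>2\<^sup>k)\<close>.
\<close>

theorem generalized_hermite:
  fixes c \<gamma> :: "nat \<Rightarrow> real"
  assumes \<gamma>: "\<And>x. -1 < (\<Sum>j\<in>{j\<in>{1..r}. c j = x}. \<gamma> j)"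
      "\<And>x. (\<Sum>j\<in>{j\<in>{1..r}. c j = x}. \<gamma> j) \<le> real k"
    and s: "0 \<le> (\<Sum>j=1..r. \<gamma> j)"
  defines "W \<equiv> \<lambda>x. power_prod r c \<gamma> x * exp (- x\<^sup>2)"
  shows "poly_integrable UNIV W"
    and "\<exists>C\<ge>0. \<forall>n P. 1 \<le> n \<longrightarrow> degree P \<le> n \<longrightarrow>
      sq_int UNIV W (pderiv P) \<le> C * (real n ^ 4 + real n ^ (2 * k + 1)) * sq_int UNIV W P"
proof -
  define A where "A = 1 + 2 * (\<Sum>j=1..r. \<bar>c j\<bar>)"
  have A1: "1 \<le> A" by (simp add: A_def sum_nonneg)
  have cA: "2 * \<bar>c j\<bar> < A" if "j \<in> {1..r}" for j
  proof -
    have "\<bar>c j\<bar> \<le> (\<Sum>j=1..r. \<bar>c j\<bar>)" using that by (intro member_le_sum) auto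
    then show ?thesis by (simp add: A_def)
  qed
  define S where "S = (\<Sum>j=1..r. \<gamma> j)"
  define w where "w = hermite_weight S"
  define I where "I = {- A..A}"
  define T where "T = - I"
  have sets: "I \<in> sets lebesgue" "T \<in> sets lebesgue" "(UNIV :: real set) \<in> sets lebesgue"
    by (auto simp: T_def I_def)
  have split: "UNIV = I \<union> T" "I \<inter> T = {}" by (auto simp: T_def)
  have W0: "0 \<le> W x" for x by (simp add: W_def)
  have w0: "0 \<le> w x" for x by (simp add: w_def)
  have meas: "W \<in> borel_measurable (lebesgue_on X)" for X
    unfolding W_def by (intro borel_imp_lebesgue_on_measurable) measurable
  have intw: "poly_integrable UNIV w"
    unfolding w_def using s by (intro poly_integrable_hermite) (simp add: S_def)
  have intwI: "poly_integrable I w" and intwT: "poly_integrable T w"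
    using sets by (auto intro!: poly_integrable_subset [OF intw w0])
  \<comment> \<open>Away from the \<open>c\<^sub>j\<close> the weight is comparable with a classical one.\<close>
  define H where "H = (\<Prod>j=1..r. 2 powr \<bar>\<gamma> j\<bar>)"
  have H: "0 < H" unfolding H_def by (intro prod_pos) auto
  have WT: "W x \<le> H * w x" and wT: "(1 / H) * w x \<le> W x" if x: "x \<in> T" for x
  proof -
    have xA: "A < \<bar>x\<bar>" using x by (auto simp: T_def I_def)
    have q: "0 < \<bar>x - c j\<bar> \<and> 0 < \<bar>x\<bar> \<and> \<bar>x - c j\<bar> \<le> 2 * \<bar>x\<bar> \<and> \<bar>x\<bar> \<le> 2 * \<bar>x - c j\<bar>" if "j \<in> {1..r}" for j
      using cA [OF that] xA A1 by (auto simp: abs_if split: if_splits)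
    have p: "(\<Prod>j=1..r. \<bar>x\<bar> powr \<gamma> j) = \<bar>x\<bar> powr S"
      using xA A1 by (simp add: S_def powr_sum)
    have 1: "power_prod r c \<gamma> x \<le> H * \<bar>x\<bar> powr S"
      unfolding p [symmetric] power_prod_def H_def using q by (intro prod_powr_comparable) blast
    have 2: "\<bar>x\<bar> powr S \<le> H * power_prod r c \<gamma> x"
      unfolding p [symmetric] power_prod_def H_def using q by (intro prod_powr_comparable) blast
    show "W x \<le> H * w x"
      using mult_right_mono [OF 1, of "exp (- x\<^sup>2)"] by (simp add: W_def w_def hermite_weight_def mult.assoc)
    have "w x \<le> H * W x"
      using mult_right_mono [OF 2, of "exp (- x\<^sup>2)"] by (simp add: W_def w_def hermite_weight_def mult.assoc)
    then show "(1 / H) * w x \<le> W x" using H by (simp add: field_simps)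
  qed
  have H': "0 < 1 / H" using H by simp
  note cmpT = comparable_weight [OF sets(2) intwT w0 meas H' wT WT]
  obtain C0 where C0: "0 \<le> C0" "markov_nikolskii k I (power_prod r c \<gamma>) C0"
    and int0: "poly_integrable I (power_prod r c \<gamma>)"
    unfolding I_def
    using generalized_jacobi [where a = "- A" and b = A and r = r and c = c and \<gamma> = \<gamma> and k = k] \<gamma> A1 by auto
  have lo: "exp (- A\<^sup>2) * power_prod r c \<gamma> x \<le> W x" and up: "W x \<le> 1 * power_prod r c \<gamma> x" if "x \<in> I" for x
  proof -
    have "x\<^sup>2 \<le> A\<^sup>2" using that by (intro abs_le_square_iff [THEN iffD1]) (auto simp: I_def)
    then show "exp (- A\<^sup>2) * power_prod r c \<gamma> x \<le> W x"
      unfolding W_def by (subst mult.commute, intro mult_left_mono) auto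
    show "W x \<le> 1 * power_prod r c \<gamma> x"
      unfolding W_def by (simp add: mult_left_le)
  qed
  have intI: "poly_integrable I W"
    by (rule comparable_weight(1) [OF sets(1) int0 _ meas _ lo up]) auto
  define C1 where "C1 = C0 * (1 + 1) / exp (- A\<^sup>2)"
  have C1: "markov_nikolskii k I W C1" "0 \<le> C1"
    unfolding C1_def by (rule markov_nikolskii_comparable [OF sets(1) int0 _ meas _ lo up _ C0]) (use C0 in auto)
  have intT: "poly_integrable T W" by (rule cmpT(1))
  show int: "poly_integrable UNIV W"
    using intI intT split unfolding poly_integrable_def by (metis integrable_Un negligible_empty)
  have add: "sq_int UNIV v Q = sq_int I v Q + sq_int T v Q" if "poly_integrable I v" "poly_integrable T v" for v Q
    unfolding sq_int_def split(1) using that split(2)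
    by (intro Henstock_Kurzweil_Integration.integral_Un sq_integrable) auto
  define B where "B = A powr S"
  have B: "0 \<le> B" by (simp add: B_def)
  have wI: "sq_int I w Q \<le> B * sq_int I (\<lambda>_. 1) Q" for Q
  proof -
    have "sq_int I w Q \<le> integral I (\<lambda>x. B * ((poly Q x)\<^sup>2 * 1))"
      unfolding sq_int_def
    proof (rule integral_le [OF sq_integrable [OF intwI] integrable_on_mult_right [OF sq_integrable]])
      show "poly_integrable I (\<lambda>_. 1)" unfolding I_def by (rule poly_integrable_1)
      show "(poly Q x)\<^sup>2 * w x \<le> B * ((poly Q x)\<^sup>2 * 1)" if "x \<in> I" for x
      proof -
        have "\<bar>x\<bar> powr S \<le> B"
          unfolding B_def using that s by (intro powr_mono2) (auto simp: S_def I_def)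
        then have "w x \<le> B * 1"
          unfolding w_def hermite_weight_def using B by (intro mult_mono) auto
        then show ?thesis using mult_left_mono [of "w x" B "(poly Q x)\<^sup>2"] by (simp add: mult_ac)
      qed
    qed
    then show ?thesis by (simp add: sq_int_def)
  qed
  show "\<exists>C\<ge>0. \<forall>n P. 1 \<le> n \<longrightarrow> degree P \<le> n \<longrightarrow>
      sq_int UNIV W (pderiv P) \<le> C * (real n ^ 4 + real n ^ (2 * k + 1)) * sq_int UNIV W P"
  proof (intro exI [of _ "C1 + 2 * H * B * C1 + 2 * H\<^sup>2"] conjI allI impI)
    show "0 \<le> C1 + 2 * H * B * C1 + 2 * H\<^sup>2" using C1 H B by simp
    fix n and P :: "real poly"
    assume n: "1 \<le> n" "degree P \<le> n"
    let ?N = "real n"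
    have markov: "sq_int I W (pderiv P) \<le> C1 * (?N\<^sup>2)\<^sup>2 * sq_int I W P"
      and nikolskii: "sq_int I (\<lambda>_. 1) P \<le> C1 * ?N ^ (2 * k) * sq_int I W P"
      using C1(1) n unfolding markov_nikolskii_def by auto
    have T0: "sq_int T w P \<le> H * sq_int T W P"
      using cmpT(2) [of P] H by (simp add: field_simps)
    have X: "0 \<le> sq_int I W P" "0 \<le> sq_int T W P"
      by (rule sq_int_nonneg [OF intI W0], rule sq_int_nonneg [OF intT W0])
    have "sq_int T W (pderiv P) \<le> H * sq_int T w (pderiv P)"
      by (rule cmpT(3))
    also have "\<dots> \<le> H * sq_int UNIV w (pderiv P)"
      using add [OF intwI intwT, of "pderiv P"] sq_int_nonneg [OF intwI w0, of "pderiv P"] H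
      by (intro mult_left_mono) auto
    also have "\<dots> \<le> H * (2 * ?N * sq_int UNIV w P)"
      unfolding w_def using H s n by (intro mult_left_mono hermite_markov) (auto simp: S_def)
    also have "\<dots> \<le> H * (2 * ?N * (B * (C1 * ?N ^ (2 * k) * sq_int I W P) + H * sq_int T W P))"
    proof -
      have "sq_int I w P \<le> B * (C1 * ?N ^ (2 * k) * sq_int I W P)"
        using wI [of P] mult_left_mono [OF nikolskii B] by linarith
      then show ?thesis
        unfolding add [OF intwI intwT] using T0 H by (intro mult_left_mono add_mono) auto
    qed
    also have "\<dots> = (2 * H * B * C1) * (?N ^ (2 * k + 1) * sq_int I W P) + (2 * H\<^sup>2) * (?N * sq_int T W P)"
      by (simp add: algebra_simps power2_eq_square)
    finally have "sq_int UNIV W (pderiv P) \<le> C1 * (?N ^ 4 * sq_int I W P)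
        + ((2 * H * B * C1) * (?N ^ (2 * k + 1) * sq_int I W P) + (2 * H\<^sup>2) * (?N * sq_int T W P))"
      using add [OF intI intT, of "pderiv P"] markov by simp
    also have "\<dots> \<le> C1 * ((?N ^ 4 + ?N ^ (2 * k + 1)) * sq_int UNIV W P)
        + ((2 * H * B * C1) * ((?N ^ 4 + ?N ^ (2 * k + 1)) * sq_int UNIV W P)
          + (2 * H\<^sup>2) * ((?N ^ 4 + ?N ^ (2 * k + 1)) * sq_int UNIV W P))"
    proof -
      have "?N ^ 1 \<le> ?N ^ 4" using n by (intro power_increasing) auto
      then have "?N \<le> ?N ^ 4 + ?N ^ (2 * k + 1)" using n by (simp add: add_increasing2)
      moreover have "sq_int I W P \<le> sq_int UNIV W P" "sq_int T W P \<le> sq_int UNIV W P"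
        using X add [OF intI intT, of P] by auto
      ultimately show ?thesis
        using C1 H B X by (intro add_mono mult_left_mono mult_mono) auto
    qed
    also have "\<dots> = (C1 + 2 * H * B * C1 + 2 * H\<^sup>2) * (?N ^ 4 + ?N ^ (2 * k + 1)) * sq_int UNIV W P"
      by (simp add: algebra_simps)
    finally show "sq_int UNIV W (pderiv P)
      \<le> (C1 + 2 * H * B * C1 + 2 * H\<^sup>2) * (?N ^ 4 + ?N ^ (2 * k + 1)) * sq_int UNIV W P" .
  qed
qed

section \<open>Sobolev inequalities for the six families\<close>

lemma sobolev_markov_bounded_factor:
  fixes w K :: "_ \<Rightarrow> real"
  assumes I: "I \<in> sets lebesgue" "I \<noteq> {}" and m: "0 < m"
    and w: "\<And>x. 0 \<le> w x" and int: "poly_integrable I w" and K: "\<And>n. 0 \<le> K n"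
    and C: "0 \<le> C" "\<And>n P. 1 \<le> n \<Longrightarrow> degree P \<le> n \<Longrightarrow> sq_int I w (pderiv P) \<le> C * (K n)\<^sup>2 * sq_int I w P"
  shows "\<exists>C'. \<forall>h. bounded_factor I m M h \<longrightarrow> sobolev_markov I (\<lambda>x. h x * w x) (\<lambda>n. C' * K n)"
proof (intro exI [of _ "sqrt (M / m) * sqrt C"] allI impI)
  fix h assume h: "bounded_factor I m M h"
  have "L2_markov I (\<lambda>x. h x * w x) (\<lambda>n. sqrt (M / m) * (sqrt C * K n))"
    by (rule L2_markov_bounded_factor [OF I m h w int]) (use C K in \<open>auto simp: power_mult_distrib\<close>)
  then show "sobolev_markov I (\<lambda>x. h x * w x) (\<lambda>n. sqrt (M / m) * sqrt C * K n)"
    using h w m unfolding mult.assoc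
    by (intro sobolev_markov_if_L2_markov mult_nonneg_nonneg) (force simp: bounded_factor_def)+
qed

text \<open>
  For distinct \<open>c\<^sub>j\<close> the sum of the exponents at a point has at most one term.
\<close>

lemma point_sum_strict_mono:
  fixes c \<gamma> :: "nat \<Rightarrow> real"
  assumes c: "strict_mono_on {1..r} c"
    and Q: "Q 0" "\<And>j. j \<in> {1..r} \<Longrightarrow> c j = x \<Longrightarrow> Q (\<gamma> j)"
  shows "Q (\<Sum>j\<in>{j\<in>{1..r}. c j = x}. \<gamma> j)"
proof (cases "\<exists>i\<in>{1..r}. c i = x")
  case True
  then obtain i where i: "i \<in> {1..r}" "c i = x" by blast
  then have "{j\<in>{1..r}. c j = x} = {i}"
    using strict_mono_on_imp_inj_on [OF c] by (auto dest: inj_onD)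
  then show ?thesis using Q(2) [OF i] by simp
next
  case False
  then have "{j\<in>{1..r}. c j = x} = {}" by blast
  then show ?thesis using Q(1) by (simp only: sum.empty)
qed

lemma b_exponent_ge:
  assumes "1 \<le> p" "p \<le> r"
  shows "2 \<le> b_exponent p r \<gamma>" "j \<in> {p..r} \<Longrightarrow> 2 * \<gamma> j + 2 \<le> b_exponent p r \<gamma>"
proof -
  let ?g = "\<lambda>j. pad p r \<gamma> j + pad p r \<gamma> (j + 1) + \<bar>pad p r \<gamma> j - pad p r \<gamma> (j + 1)\<bar> + 2"
  have ge: "?g i \<le> b_exponent p r \<gamma>" if "i \<in> {p - 1..r}" for i
    unfolding b_exponent_def using that by (intro Max_ge) auto
  have "pad p r \<gamma> (p - 1) = 0" using assms by (auto simp: pad_def)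
  then have "2 \<le> ?g (p - 1)" by linarith
  also have "\<dots> \<le> b_exponent p r \<gamma>" using assms by (intro ge) auto
  finally show "2 \<le> b_exponent p r \<gamma>" .
  show "2 * \<gamma> j + 2 \<le> b_exponent p r \<gamma>" if j: "j \<in> {p..r}"
  proof -
    have "2 * pad p r \<gamma> j + 2 \<le> ?g j" by linarith
    also have "\<dots> \<le> b_exponent p r \<gamma>" using j by (intro ge) auto
    finally show ?thesis using j by (simp add: pad_def)
  qed
qed

lemma hermite_sobolev:
  assumes "0 \<le> \<alpha>"
  shows "sobolev_markov UNIV (hermite_weight \<alpha>) (\<lambda>n. sqrt (2 * real n))"
proof (rule sobolev_markov_if_L2_markov)
  show "L2_markov UNIV (hermite_weight \<alpha>) (\<lambda>n. sqrt (2 * real n))"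
    unfolding L2_markov_def
  proof (intro allI impI)
    fix n and P :: "real poly"
    assume "degree P \<le> n"
    from real_sqrt_le_mono [OF hermite_markov [OF assms this]]
    show "L2_norm_wt UNIV (hermite_weight \<alpha>) (pderiv P) \<le> sqrt (2 * real n) * L2_norm_wt UNIV (hermite_weight \<alpha>) P"
      by (simp add: L2_norm_wt_eq poly_integrable_hermite assms real_sqrt_mult)
  qed
qed simp

lemma generalized_jacobi_sobolev:
  fixes a b m M :: real
  assumes "a < b" "0 < m" and \<gamma>: "\<And>x. x \<in> {a..b} \<Longrightarrow> -1 < (\<Sum>j\<in>{j\<in>{1..r}. c j = x}. \<gamma> j)"
  shows "\<exists>C. \<forall>h. bounded_factor {a..b} m M h \<longrightarrow>
         sobolev_markov {a..b} (\<lambda>x. h x * power_prod r c \<gamma> x) (\<lambda>n. C * (real n)\<^sup>2)"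
proof -
  define k where "k = nat \<lceil>\<Sum>j=1..r. \<bar>\<gamma> j\<bar>\<rceil>"
  obtain C where C: "0 \<le> C" "markov_nikolskii k {a..b} (power_prod r c \<gamma>) C"
    and int: "poly_integrable {a..b} (power_prod r c \<gamma>)"
    using generalized_jacobi [where a = a and b = b and r = r and c = c and \<gamma> = \<gamma> and k = k, OF assms(1) \<gamma>]
      point_sum_le [where c = c and r = r and \<gamma> = \<gamma>] by (auto simp: k_def)
  show ?thesis
    by (rule sobolev_markov_bounded_factor [OF _ _ assms(2) _ int _ C(1)])
      (use assms(1) C(2) in \<open>auto simp: markov_nikolskii_def\<close>)
qed

text \<open>
  Stated for an arbitrary majorant \<open>K\<close> of \<open>n\<^sup>2\<close>, so that it covers \<open>n\<^sup>2\<close> itself as well as every power of \<open>n\<close>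
  with exponent at least \<open>2\<close>.
\<close>

lemma generalized_laguerre_sobolev:
  fixes c \<gamma> :: "nat \<Rightarrow> real" and K :: "nat \<Rightarrow> real"
  assumes m: "0 < m" and c: "strict_mono_on {1..r} c" and \<gamma>: "\<And>j. j \<in> {1..r} \<Longrightarrow> 0 \<le> c j \<Longrightarrow> -1 < \<gamma> j"
    and K: "\<And>n. 0 \<le> K n" "\<And>n. 1 \<le> n \<Longrightarrow> (real n)\<^sup>2 \<le> K n"
  shows "\<exists>C. \<forall>h. bounded_factor {0..} m M h \<longrightarrow>
         sobolev_markov {0..} (\<lambda>x. h x * power_prod r c \<gamma> x * exp (- x)) (\<lambda>n. C * K n)"
proof -
  let ?W = "\<lambda>x. power_prod r c \<gamma> x * exp (- x)"
  have "-1 < (\<Sum>j\<in>{j\<in>{1..r}. c j = x}. \<gamma> j)" if "0 \<le> x" for x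
    by (rule point_sum_strict_mono [OF c]) (use \<gamma> that in auto)
  note gl = generalized_laguerre [where r = r and c = c and \<gamma> = \<gamma>, OF this]
  obtain C where C: "0 \<le> C" "\<And>n P. 1 \<le> n \<Longrightarrow> degree P \<le> n \<Longrightarrow>
      sq_int {0..} ?W (pderiv P) \<le> C * ((real n)\<^sup>2)\<^sup>2 * sq_int {0..} ?W P"
    using gl(2) by blast
  have int: "poly_integrable {0..} ?W" using gl(1) by blast
  show ?thesis
    unfolding mult.assoc
  proof (rule sobolev_markov_bounded_factor [OF _ _ m _ int K(1) C(1)])
    fix n and P :: "real poly"
    assume n: "1 \<le> n" "degree P \<le> n"
    have "((real n)\<^sup>2)\<^sup>2 \<le> (K n)\<^sup>2" using K n by (intro power_mono) auto
    then have "C * ((real n)\<^sup>2)\<^sup>2 * sq_int {0..} ?W P \<le> C * (K n)\<^sup>2 * sq_int {0..} ?W P"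
      using C(1) by (intro mult_right_mono mult_left_mono sq_int_nonneg [OF int]) auto
    then show "sq_int {0..} ?W (pderiv P) \<le> C * (K n)\<^sup>2 * sq_int {0..} ?W P"
      using C(2) [OF n] by linarith
  qed auto
qed

text \<open>
  The least integer \<open>k\<close> with \<open>k \<ge> (b - 2) / 2\<close> satisfies \<open>k \<ge> \<gamma>\<^sub>j\<close> for all \<open>j\<close>, and it is at most
  \<open>b / 2\<close>, so \<open>2 k + 1 \<le> b + 1 \<le> 2 a\<close>.
\<close>

lemma generalized_hermite_sobolev:
  fixes c \<gamma> :: "nat \<Rightarrow> real"
  assumes r: "1 \<le> r" and m: "0 < m" and c: "strict_mono_on {1..r} c" and \<gamma>: "\<And>j. j \<in> {1..r} \<Longrightarrow> -1 < \<gamma> j"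
    and s: "0 \<le> (\<Sum>j=1..r. \<gamma> j)"
    and a: "a = max 2 ((b_exponent 1 r \<gamma> + 1) / 2)"
  shows "\<exists>C. \<forall>h. bounded_factor UNIV m M h \<longrightarrow>
         sobolev_markov UNIV (\<lambda>x. h x * power_prod r c \<gamma> x * exp (- x\<^sup>2)) (\<lambda>n. C * real n powr a)"
proof -
  let ?W = "\<lambda>x. power_prod r c \<gamma> x * exp (- x\<^sup>2)"
  let ?b = "b_exponent 1 r \<gamma>"
  define k where "k = nat \<lceil>(?b - 2) / 2\<rceil>"
  have b: "2 \<le> ?b" "\<And>j. j \<in> {1..r} \<Longrightarrow> 2 * \<gamma> j + 2 \<le> ?b"
    using b_exponent_ge [where p = 1 and r = r and \<gamma> = \<gamma>] r by auto
  have k: "(?b - 2) / 2 \<le> real k" "real k \<le> (?b - 2) / 2 + 1"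
  proof -
    have "real k = of_int \<lceil>(?b - 2) / 2\<rceil>"
      unfolding k_def using b(1) by (subst of_nat_nat) auto
    then show "(?b - 2) / 2 \<le> real k" "real k \<le> (?b - 2) / 2 + 1"
      by (simp_all only: le_of_int_ceiling of_int_ceiling_le_add_one)
  qed
  have "-1 < (\<Sum>j\<in>{j\<in>{1..r}. c j = x}. \<gamma> j)" for x
    by (rule point_sum_strict_mono [OF c]) (use \<gamma> in auto)
  moreover have "(\<Sum>j\<in>{j\<in>{1..r}. c j = x}. \<gamma> j) \<le> real k" for x
    by (rule point_sum_strict_mono [OF c]) (use b(2) k(1) in \<open>simp, fastforce\<close>)
  ultimately have gh: "poly_integrable UNIV ?W" "\<exists>C\<ge>0. \<forall>n P. 1 \<le> n \<longrightarrow> degree P \<le> n \<longrightarrow>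
      sq_int UNIV ?W (pderiv P) \<le> C * (real n ^ 4 + real n ^ (2 * k + 1)) * sq_int UNIV ?W P"
    using generalized_hermite [where r = r and c = c and \<gamma> = \<gamma> and k = k] s by auto
  obtain C where C: "0 \<le> C" "\<And>n P. 1 \<le> n \<Longrightarrow> degree P \<le> n \<Longrightarrow>
      sq_int UNIV ?W (pderiv P) \<le> C * (real n ^ 4 + real n ^ (2 * k + 1)) * sq_int UNIV ?W P"
    using gh(2) by blast
  have C2: "0 \<le> 2 * C" using C(1) by simp
  show ?thesis
    unfolding mult.assoc
  proof (rule sobolev_markov_bounded_factor [OF _ _ m _ gh(1) _ C2])
    fix n and P :: "real poly"
    assume n: "1 \<le> n" "degree P \<le> n"
    have pow: "real n ^ i \<le> (real n powr a)\<^sup>2" if "real i \<le> 2 * a" for i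
    proof -
      have "real n ^ i = real n powr real i" using n by (simp add: powr_realpow)
      also have "\<dots> \<le> real n powr (a + a)" using n that by (intro powr_mono) auto
      finally show ?thesis by (simp only: powr_add power2_eq_square)
    qed
    have "real n ^ 4 \<le> (real n powr a)\<^sup>2" using a by (intro pow) simp
    moreover have "real n ^ (2 * k + 1) \<le> (real n powr a)\<^sup>2"
    proof (rule pow)
      have "(?b + 1) / 2 \<le> a" using a by simp
      then show "real (2 * k + 1) \<le> 2 * a"
      proof -
        have 1: "?b + 1 \<le> 2 * a" using \<open>(?b + 1) / 2 \<le> a\<close> by (simp add: field_simps del: One_nat_def)
        have 2: "2 * real k \<le> ?b" using k(2) by (simp add: field_simps del: One_nat_def)
        show ?thesis using 1 2 by simp
      qed
    qed
    ultimately have "real n ^ 4 + real n ^ (2 * k + 1) \<le> 2 * (real n powr a)\<^sup>2" by simp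
    then have "C * (real n ^ 4 + real n ^ (2 * k + 1)) * sq_int UNIV ?W P
        \<le> C * (2 * (real n powr a)\<^sup>2) * sq_int UNIV ?W P"
      using C(1) by (intro mult_right_mono mult_left_mono sq_int_nonneg [OF gh(1)]) auto
    then show "sq_int UNIV ?W (pderiv P) \<le> 2 * C * (real n powr a)\<^sup>2 * sq_int UNIV ?W P"
      using C(2) [OF n] by (simp add: mult_ac)
  qed auto
qed

theorem theorem2p1:
  shows
  \<comment> \<open>(1)\<close>
  "(\<forall>\<alpha> C :: real. \<alpha> > -1 \<longrightarrow>
      L2_markov {0..} (laguerre_weight \<alpha>) (\<lambda>n. C * real n) \<longrightarrow>
      sobolev_markov {0..} (laguerre_weight \<alpha>) (\<lambda>n. C * real n))
  \<and> \<comment> \<open>(2)\<close>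
   (\<forall>\<alpha> :: real. \<alpha> \<ge> 0 \<longrightarrow>
      sobolev_markov UNIV (hermite_weight \<alpha>) (\<lambda>n. sqrt (2 * real n)))
  \<and> \<comment> \<open>(3)\<close>
   (\<forall>\<alpha> \<beta> C :: real. \<alpha> > -1 \<longrightarrow> \<beta> > -1 \<longrightarrow>
      L2_markov {-1..1} (jacobi_weight \<alpha> \<beta>) (\<lambda>n. C * (real n)\<^sup>2) \<longrightarrow>
      sobolev_markov {-1..1} (jacobi_weight \<alpha> \<beta>) (\<lambda>n. C * (real n)\<^sup>2))
  \<and> \<comment> \<open>(4)\<close>
   (\<forall>(a :: real) b r (c :: nat \<Rightarrow> real) \<gamma> (m :: real) M.
      a < b \<longrightarrow> 1 \<le> r \<longrightarrow> 0 < m \<longrightarrow>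
      (\<forall>j\<in>{1..r}. c j \<in> {a..b} \<longrightarrow> \<gamma> j > -1) \<longrightarrow>
      (\<forall>x\<in>{a..b}. (\<Sum>j\<in>{j\<in>{1..r}. c j = x}. \<gamma> j) > -1) \<longrightarrow>
      (\<exists>C1. \<forall>h. bounded_factor {a..b} m M h \<longrightarrow>
         sobolev_markov {a..b} (\<lambda>x. h x * power_prod r c \<gamma> x) (\<lambda>n. C1 * (real n)\<^sup>2)))
  \<and> \<comment> \<open>(5)\<close>
   (\<forall>r (c :: nat \<Rightarrow> real) \<gamma> (m :: real) M.
      1 \<le> r \<longrightarrow> 0 < m \<longrightarrow> strict_mono_on {1..r} c \<longrightarrow> c r \<ge> 0 \<longrightarrow>
      (\<forall>j\<in>{1..r}. c j \<ge> 0 \<longrightarrow> \<gamma> j > -1) \<longrightarrow>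
      \<comment> \<open>(5.1)\<close>
      ((\<Sum>j=1..r - 1. \<gamma> j) = 0 \<longrightarrow>
        (\<exists>C2. \<forall>h. bounded_factor {0..} m M h \<longrightarrow>
           sobolev_markov {0..} (\<lambda>x. h x * power_prod r c \<gamma> x * exp (- x))
             (\<lambda>n. C2 * (real n)\<^sup>2)))
      \<and> \<comment> \<open>(5.2)\<close>
      (let r0 = first_nonneg r c; \<gamma>' = pad r0 r \<gamma>;
           b' = b_exponent r0 r \<gamma>; a' = max 2 ((b' + 2) / 2)
       in (\<Sum>j=1..r. \<gamma> j) > -1 \<longrightarrow>
          (\<forall>j\<in>{r0 - 1..r}. max (\<gamma>' j) (\<gamma>' (j + 1)) \<ge> -1/2) \<longrightarrow>
          (\<exists>C2'. \<forall>h. bounded_factor {0..} m M h \<longrightarrow>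
             sobolev_markov {0..} (\<lambda>x. h x * power_prod r c \<gamma> x * exp (- x))
               (\<lambda>n. C2' * real n powr a'))))
  \<and> \<comment> \<open>(6)\<close>
   (\<forall>r (c :: nat \<Rightarrow> real) \<gamma> (m :: real) M.
      1 \<le> r \<longrightarrow> 0 < m \<longrightarrow> strict_mono_on {1..r} c \<longrightarrow>
      (\<forall>j\<in>{1..r}. \<gamma> j > -1) \<longrightarrow> (\<Sum>j=1..r. \<gamma> j) \<ge> 0 \<longrightarrow>
      (let \<gamma>' = pad 1 r \<gamma>; b = b_exponent 1 r \<gamma>; a = max 2 ((b + 1) / 2)
       in (\<forall>j\<in>{0..r}. max (\<gamma>' j) (\<gamma>' (j + 1)) \<ge> -1/2) \<longrightarrow>
          (\<exists>C3. \<forall>h. bounded_factor UNIV m M h \<longrightarrow>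
             sobolev_markov UNIV (\<lambda>x. h x * power_prod r c \<gamma> x * exp (- x\<^sup>2))
               (\<lambda>n. C3 * real n powr a))))"
proof (intro conjI allI impI)
  fix \<alpha> C :: real
  assume "L2_markov {0..} (laguerre_weight \<alpha>) (\<lambda>n. C * real n)"
  then show "sobolev_markov {0..} (laguerre_weight \<alpha>) (\<lambda>n. C * real n)"
    by (intro sobolev_markov_if_L2_markov) (simp_all add: laguerre_weight_def)
next
  fix \<alpha> :: real
  assume "0 \<le> \<alpha>"
  then show "sobolev_markov UNIV (hermite_weight \<alpha>) (\<lambda>n. sqrt (2 * real n))"
    by (rule hermite_sobolev)
next
  fix \<alpha> \<beta> C :: real
  assume "L2_markov {-1..1} (jacobi_weight \<alpha> \<beta>) (\<lambda>n. C * (real n)\<^sup>2)"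
  then show "sobolev_markov {-1..1} (jacobi_weight \<alpha> \<beta>) (\<lambda>n. C * (real n)\<^sup>2)"
    by (intro sobolev_markov_if_L2_markov) (simp_all add: jacobi_weight_def)
next
  fix a b :: real and r and c \<gamma> :: "nat \<Rightarrow> real" and m M :: real
  assume "a < b" "0 < m" "\<forall>x\<in>{a..b}. (\<Sum>j\<in>{j\<in>{1..r}. c j = x}. \<gamma> j) > -1"
  then show "\<exists>C1. \<forall>h. bounded_factor {a..b} m M h \<longrightarrow>
      sobolev_markov {a..b} (\<lambda>x. h x * power_prod r c \<gamma> x) (\<lambda>n. C1 * (real n)\<^sup>2)"
    by (intro generalized_jacobi_sobolev) auto
next
  fix r and c \<gamma> :: "nat \<Rightarrow> real" and m M :: real
  assume "0 < m" "strict_mono_on {1..r} c" "\<forall>j\<in>{1..r}. c j \<ge> 0 \<longrightarrow> \<gamma> j > -1"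
  then show "\<exists>C2. \<forall>h. bounded_factor {0..} m M h \<longrightarrow>
      sobolev_markov {0..} (\<lambda>x. h x * power_prod r c \<gamma> x * exp (- x)) (\<lambda>n. C2 * (real n)\<^sup>2)"
    by (intro generalized_laguerre_sobolev) auto
next
  fix r and c \<gamma> :: "nat \<Rightarrow> real" and m M :: real
  assume asm: "0 < m" "strict_mono_on {1..r} c" "\<forall>j\<in>{1..r}. c j \<ge> 0 \<longrightarrow> \<gamma> j > -1"
  have "\<exists>C2'. \<forall>h. bounded_factor {0..} m M h \<longrightarrow>
      sobolev_markov {0..} (\<lambda>x. h x * power_prod r c \<gamma> x * exp (- x)) (\<lambda>n. C2' * real n powr max 2 d)" for d
  proof (rule generalized_laguerre_sobolev [OF asm(1,2)])
    show "(real n)\<^sup>2 \<le> real n powr max 2 d" if "1 \<le> n" for n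
    proof -
      have "(real n)\<^sup>2 = real n powr 2" using that by simp
      also have "\<dots> \<le> real n powr max 2 d" using that by (intro powr_mono) auto
      finally show ?thesis .
    qed
  qed (use asm in auto)
  then show "let r0 = first_nonneg r c; \<gamma>' = pad r0 r \<gamma>; b' = b_exponent r0 r \<gamma>; a' = max 2 ((b' + 2) / 2)
       in (\<Sum>j=1..r. \<gamma> j) > -1 \<longrightarrow>
          (\<forall>j\<in>{r0 - 1..r}. max (\<gamma>' j) (\<gamma>' (j + 1)) \<ge> -1/2) \<longrightarrow>
          (\<exists>C2'. \<forall>h. bounded_factor {0..} m M h \<longrightarrow>
             sobolev_markov {0..} (\<lambda>x. h x * power_prod r c \<gamma> x * exp (- x))
               (\<lambda>n. C2' * real n powr a'))"
    unfolding Let_def by blast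
next
  fix r and c \<gamma> :: "nat \<Rightarrow> real" and m M :: real
  assume "1 \<le> r" "0 < m" "strict_mono_on {1..r} c" "\<forall>j\<in>{1..r}. \<gamma> j > -1" "(\<Sum>j=1..r. \<gamma> j) \<ge> 0"
  then show "let \<gamma>' = pad 1 r \<gamma>; b = b_exponent 1 r \<gamma>; a = max 2 ((b + 1) / 2)
       in (\<forall>j\<in>{0..r}. max (\<gamma>' j) (\<gamma>' (j + 1)) \<ge> -1/2) \<longrightarrow>
          (\<exists>C3. \<forall>h. bounded_factor UNIV m M h \<longrightarrow>
             sobolev_markov UNIV (\<lambda>x. h x * power_prod r c \<gamma> x * exp (- x\<^sup>2))
               (\<lambda>n. C3 * real n powr a))"
    unfolding Let_def by (intro impI generalized_hermite_sobolev) auto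
qed

end
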